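(* Let $\sigma>0$, $\alpha,\beta\in\mathbb C\setminus\{0\}$, $\lambda=\alpha+\beta$, $\eta=\alpha\beta$, and let $(p_n(z))_{n=0}^\infty$ be the monic polynomial sequence with $p_0=1$ satisfying $zp_n(z)=p_{n+1}(z)+(\lambda n+\sigma/\alpha)p_n(z)+(\sigma n+\eta n(n-1))p_{n-1}(z)$, $n\in\mathbb N_0$. Let $\Phi:\mathcal P(\mathbb C)\to\mathbb C$ be the linear functional defined by $\Phi(1)=1$ and $\Phi(p_n)=0$ for all $n\in\mathbb N$. Then, for all $n\in\mathbb N$, $$\Phi(z^n)=\sum_{k=1}^n(\alpha-\beta)^{n-k}S(n,k)\,(\sigma/\alpha\mid-\beta)_k.$$ In particular, for $\alpha\ge\beta>0$, $$\int_{\mathbb R}x^n\,\mu_{\alpha,\beta,\sigma}(dx)=\sum_{k=1}^n(\alpha-\beta)^{n-k}S(n,k)\,(\sigma/\alpha\mid-\beta)_k,$$ and for $\Re(\alpha)\ge0$, $\Im(\alpha)>0$, $\beta=\overline\alpha$, $$\int_{\mathbb R}(x+\sigma/\alpha)^n\,\mu_{\alpha,\beta,\sigma}(dx)=\sum_{k=1}^n(\alpha-\beta)^{n-k}S(n,k)\,(\sigma/\alpha\mid-\beta)_k.$$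
   Context: $\mathcal P(\mathbb C)$ is the space of complex polynomials; $\mathbb N=\{1,2,\dots\}$, $\mathbb N_0=\mathbb N\cup\{0\}$; $(z\mid h)_0=1$, $(z\mid h)_n=z(z-h)\cdots(z-(n-1)h)$; $(z)^{(n)}=(z\mid-1)_n$; $S(n,k)$ are Stirling numbers of the second kind; $0^0=1$. The probability measures $\mu_{\alpha,\beta,\sigma}$ are: - $\alpha=\beta>0$: $\mu_{\alpha,\alpha,\sigma}(dx)=\frac1{\Gamma(\sigma/\eta)}\alpha^{-\sigma/\eta}x^{-1+\sigma/\eta}e^{-x/\alpha}dx$ on $(0,\infty)$; - $\alpha>\beta>0$: $\mu_{\alpha,\beta,\sigma}=(1-\frac\beta\alpha)^{\sigma/\eta}\sum_{n\ge0}(\frac\beta\alpha)^n\frac1{n!}(\frac\sigma\eta)^{(n)}\delta_{(\alpha-\beta)n}$; - $\Re(\alpha)\ge0$, $\Im(\alpha)>0$, $\beta=\overline\alpha$: $\mu_{\alpha,\beta,\sigma}(dx)=C_{\alpha,\beta,\sigma}\exp\big((\frac\pi2-\operatorname{Arg}(\alpha))x/\Im(\alpha)\big)\big|\Gamma\big(\frac{ix}{2\Im(\alpha)}+\frac{i\sigma\beta}{2\eta\Im(\alpha)}\big)\big|^2dx$ on $\mathbb R$, $\operatorname{Arg}(\alpha)\in(0,\pi/2]$, $C_{\alpha,\beta,\sigma}=\frac{(2\cos(\frac\pi2-\operatorname{Arg}(\alpha)))^{\sigma/\eta}}{4\Im(\alpha)\pi\Gamma(\sigma/\eta)}\exp\big(\frac{(\frac\pi2-\operatorname{Arg}(\alpha))\sigma\Re(\alpha)}{\Im(\alpha)\eta}\big)$.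 For $\alpha\ge\beta>0$, $\mu_{\alpha,\beta,\sigma}$ is the orthogonality measure of $(p_n(x))_{n\ge0}$; for $\beta=\overline\alpha$ as in the third case, it is the orthogonality measure of the polynomials $s_n(x)=p_n(x+\sigma/\alpha)$ (which have real coefficients). *)

theory Defs
  imports
    "HOL-Probability.Probability"
    "HOL-Computational_Algebra.Polynomial"
    "HOL-Combinatorics.Stirling"
begin

text \<open>
  The generalized falling factorial $(z \mid h)_n = z (z - h) \cdots (z - (n-1) h)$.
\<close>

definition gen_ffact :: "complex \<Rightarrow> complex \<Rightarrow> nat \<Rightarrow> complex" where
  "gen_ffact z h n = (\<Prod>i<n. z - of_nat i * h)"

definition meixner_gamma_measure :: "real \<Rightarrow> real \<Rightarrow> real measure" where
  "meixner_gamma_measure a \<sigma> =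
     (let \<eta> = a * a in
      density lborel (\<lambda>x. ennreal (indicator {0<..} x *
        (1 / Gamma (\<sigma> / \<eta>) * a powr (- \<sigma> / \<eta>) * x powr (-1 + \<sigma> / \<eta>) * exp (- x / a)))))"

text \<open>
  The weighted sum of Dirac measures $\sum_n w_n \delta_{(a-b)n}$, as a Borel measure on the
  reals: it is the image of the measure on the natural numbers with point masses $w_n$
  under $n \mapsto (a-b)n$.
\<close>

definition meixner_negbinomial_measure :: "real \<Rightarrow> real \<Rightarrow> real \<Rightarrow> real measure" where
  "meixner_negbinomial_measure a b \<sigma> =
     (let \<eta> = a * b in
      distr
        (density (count_space (UNIV :: nat set)) (\<lambda>n. ennreal
          ((1 - b / a) powr (\<sigma> / \<eta>) * ((b / a) ^ n * (1 / fact n) * pochhammer (\<sigma> / \<eta>) n))))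
        borel (\<lambda>n. (a - b) * real n))"

text \<open>
  Here $\beta = \overline\alpha$, so $\eta = \alpha\beta = |\alpha|^2$ is a positive real number.
\<close>

definition meixner_pollaczek_const :: "complex \<Rightarrow> real \<Rightarrow> real" where
  "meixner_pollaczek_const \<alpha> \<sigma> =
     (let \<eta> = (cmod \<alpha>)\<^sup>2 in
      (2 * cos (pi / 2 - Arg \<alpha>)) powr (\<sigma> / \<eta>) / (4 * Im \<alpha> * pi * Gamma (\<sigma> / \<eta>)) *
      exp ((pi / 2 - Arg \<alpha>) * \<sigma> * Re \<alpha> / (Im \<alpha> * \<eta>)))"

definition meixner_pollaczek_measure :: "complex \<Rightarrow> real \<Rightarrow> real measure" where
  "meixner_pollaczek_measure \<alpha> \<sigma> =
     (let \<eta> = (cmod \<alpha>)\<^sup>2 in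
      density lborel (\<lambda>x. ennreal (meixner_pollaczek_const \<alpha> \<sigma> *
        exp ((pi / 2 - Arg \<alpha>) * x / Im \<alpha>) *
        (cmod (Gamma (\<i> * of_real x / of_real (2 * Im \<alpha>)
                    + \<i> * of_real \<sigma> * cnj \<alpha> / of_real (2 * \<eta> * Im \<alpha>))))\<^sup>2)))"

text \<open>
  The conditions of the three branches are mutually exclusive; outside of them the measure is
  not specified.
\<close>

definition meixner_measure :: "complex \<Rightarrow> complex \<Rightarrow> real \<Rightarrow> real measure" where
  "meixner_measure \<alpha> \<beta> \<sigma> =
     (if \<alpha> \<in> \<real> \<and> \<beta> = \<alpha> \<and> 0 < Re \<alpha> then meixner_gamma_measure (Re \<alpha>) \<sigma>
      else if \<alpha> \<in> \<real> \<and> \<beta> \<in> \<real> \<and> 0 < Re \<beta> \<and> Re \<beta> < Re \<alpha>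
        then meixner_negbinomial_measure (Re \<alpha>) (Re \<beta>) \<sigma>
      else if 0 \<le> Re \<alpha> \<and> 0 < Im \<alpha> \<and> \<beta> = cnj \<alpha> then meixner_pollaczek_measure \<alpha> \<sigma>
      else undefined)"

end

(* Put s = sigma / eta.  Since z^n = sum_k (alpha - beta)^(n-k) S(n,k) (z | alpha - beta)_k, all three
   formulas say that the factorial moment of (z | alpha - beta)_k is
   (sigma/alpha | -beta)_k = beta^k s (s+1) ... (s+k-1).  For Phi this follows by inverting the explicit
   triangular expansion of p_n in the basis (z | alpha - beta)_k.  For the measures the factorial moments
   are computed directly: by a Gamma integral if alpha = beta, by a binomial series if alpha > beta.  In
   the complex case the factorial turns |Gamma(u)|^2 into Gamma(u+k) cnj(Gamma(u)), whose weighted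
   integral over the line Re u = s/2 follows from Parseval's identity. *)

theory Submission
  imports Defs
begin

subsection \<open>Factorial expansions and the functional\<close>

text \<open>The parameter s is convenient because sigma/alpha = s beta and sigma n + eta n (n-1) =
  eta n (s + n - 1), so the recurrence becomes polynomial in alpha, beta and s. The factorials with
  step alpha - beta suit it because multiplying the k-th one by z involves only the indices k and k
  + 1. At alpha = beta they degenerate to powers without any division, so the argument for Phi is
  uniform. The delicate point is the complex case, where integrability would ordinarily call for the
  asymptotics of Gamma on vertical lines. Here integrability and value come together: in the
  variable y = log t, Gamma on a vertical line is the Fourier transform of a bounded, continuous,
  integrable function, and for such functions a Gaussian regularisation gives square integrability
  of the transform as well as Parseval's identity. The weight exp(2 theta t), theta = pi/2 - Arg
  alpha, is shared evenly between the two factors and absorbed by rotating the coefficient of e^y to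
  exp(i theta), which stays in the open right half-plane because 0 < Arg alpha <= pi/2.\<close>

lemma power_eq_sum_Stirling:
  fixes x d :: "'a::comm_ring_1"
  shows "x ^ n = (\<Sum>k\<le>n. d ^ (n - k) * of_nat (Stirling n k) * (\<Prod>i<k. x - of_nat i * d))"
proof (induction n)
  case (Suc n)
  define q where "q k = (\<Prod>i<k. x - of_nat i * d)" for k
  define c where "c m k = d ^ (m - k) * of_nat (Stirling m k)" for m k
  have xq: "x * q k = q (Suc k) + of_nat k * d * q k" for k
    by (simp add: q_def algebra_simps)
  \<comment> \<open>The Stirling recurrence, carrying its powers of d. For k >= n the truncated
    exponent in \<open>c n (Suc k)\<close> is harmless because the Stirling number there is
    0.\<close>
  have c_Suc: "c (Suc n) (Suc k) = c n k + of_nat (Suc k) * d * c n (Suc k)" for k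
  proof (cases "k < n")
    case True
    then have "n - k = Suc (n - Suc k)" by simp
    then show ?thesis by (simp add: c_def algebra_simps)
  qed (simp add: c_def)
  have "x ^ Suc n = (\<Sum>k\<le>n. c n k * (x * q k))"
    unfolding power_Suc Suc.IH by (simp add: q_def c_def sum_distrib_left mult_ac)
  also have "\<dots> = (\<Sum>k\<le>n. c n k * q (Suc k)) + (\<Sum>k\<le>n. of_nat k * d * c n k * q k)"
    unfolding xq by (simp add: sum.distrib algebra_simps)
  also have "(\<Sum>k\<le>n. of_nat k * d * c n k * q k) = (\<Sum>k\<le>Suc n. of_nat k * d * c n k * q k)"
    by (simp add: c_def)
  also have "\<dots> = (\<Sum>k\<le>n. of_nat (Suc k) * d * c n (Suc k) * q (Suc k))"
    by (subst sum.atMost_Suc_shift) simp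
  also have "(\<Sum>k\<le>n. c n k * q (Suc k)) + \<dots> = (\<Sum>k\<le>n. c (Suc n) (Suc k) * q (Suc k))"
    unfolding c_Suc by (simp add: sum.distrib algebra_simps)
  also have "\<dots> = (\<Sum>k\<le>Suc n. c (Suc n) k * q k)"
    by (subst sum.atMost_Suc_shift) (simp add: c_def)
  finally show ?case by (simp add: q_def c_def)
qed simp

lemma sum_Stirling_from_1:
  fixes f :: "nat \<Rightarrow> 'a::comm_ring_1"
  assumes "n \<ge> 1"
  shows "(\<Sum>k\<le>n. g k * of_nat (Stirling n k) * f k) = (\<Sum>k=1..n. g k * of_nat (Stirling n k) * f k)"
proof -
  have "Stirling n 0 = 0"
    using assms by (cases n) auto
  moreover have "{..n} = insert 0 {1..n}" by auto
  ultimately show ?thesis by simp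
qed

lemma gen_ffact_uminus_eq_pochhammer:
  "gen_ffact (s * b) (- b) k = b ^ k * pochhammer s k"
proof -
  have "gen_ffact (s * b) (- b) k = (\<Prod>i<k. b * (s + of_nat i))"
    unfolding gen_ffact_def by (intro prod.cong) (auto simp: algebra_simps)
  then show ?thesis
    by (simp add: prod.distrib pochhammer_prod atLeast0LessThan)
qed

text \<open>
  The entries of the triangular matrix expressing $p_n$ through the factorials
  $(z \mid a-b)_k$, where $s = \sigma/(ab)$; they come from the hypergeometric form
  of the Meixner polynomials.
\<close>

definition meixner_coeff :: "complex \<Rightarrow> complex \<Rightarrow> nat \<Rightarrow> nat \<Rightarrow> complex" where
  "meixner_coeff b s n k = of_nat (n choose k) * (- b) ^ (n - k) * pochhammer (s + of_nat k) (n - k)"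

lemma meixner_coeff_eq_0: "n < k \<Longrightarrow> meixner_coeff b s n k = 0"
  by (simp add: meixner_coeff_def)

text \<open>This is the three-term recurrence read off coefficientwise in the factorial basis: the
  left side is the k-th coefficient of z times the expansion, since z (z | a-b)_k = (z | a-b)_(k+1)
  + k (a-b) (z | a-b)_k. At n = 0 the truncated \<open>n - 1\<close> is multiplied by 0.\<close>

lemma meixner_coeff_recurrence:
  fixes a b s :: complex
  defines "A \<equiv> meixner_coeff b s"
  shows "(if k = 0 then 0 else A n (k - 1)) + of_nat k * (a - b) * A n k
    = A (Suc n) k + ((a + b) * of_nat n + s * b) * A n k
      + a * b * of_nat n * (s + of_nat n - 1) * A (n - 1) k"
proof -
  \<comment> \<open>The generic case is n = k + 1 + m, where all terms share the factor (-b)^m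
    (s+k)...(s+k+m-1). Near and above the diagonal this factor does not exist, so those entries are
    handled separately.\<close>
  consider "k > Suc n" | "k = Suc n" | "k = n" | m where "n = Suc (k + m)"
    by (metis add_Suc_right less_imp_Suc_add linorder_neqE_nat not_less_eq)
  then show ?thesis
  proof cases
    case 1
    then show ?thesis by (simp add: A_def meixner_coeff_eq_0)
  next
    case 2
    have "A n k = 0" "A (n - 1) k = 0" "A n n = 1" "A (Suc n) (Suc n) = 1"
      using 2 by (simp_all add: A_def meixner_coeff_eq_0 meixner_coeff_def)
    then show ?thesis using 2 by simp
  next
    case 3
    show ?thesis
    proof (cases k)
      case 0
      then show ?thesis using 3 by (simp add: A_def meixner_coeff_def)
    next
      case (Suc j)
      have "Suc j choose j = Suc j" "Suc (Suc j) choose Suc j = Suc (Suc j)"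
        using binomial_symmetric[of j "Suc j"] binomial_symmetric[of "Suc j" "Suc (Suc j)"] by simp_all
      then have e: "A (Suc j) j = of_nat (Suc j) * - b * (s + of_nat j)"
        "A (Suc (Suc j)) (Suc j) = of_nat (Suc (Suc j)) * - b * (s + of_nat (Suc j))"
        "A (Suc j) (Suc j) = 1" "A j (Suc j) = 0"
        by (simp_all add: A_def meixner_coeff_def del: binomial_Suc_Suc of_nat_Suc)
      then have "(if Suc j = 0 then 0 else A (Suc j) (Suc j - 1)) + of_nat (Suc j) * (a - b) * A (Suc j) (Suc j)
        = A (Suc (Suc j)) (Suc j) + ((a + b) * of_nat (Suc j) + s * b) * A (Suc j) (Suc j)
          + a * b * of_nat (Suc j) * (s + of_nat (Suc j) - 1) * A (Suc j - 1) (Suc j)"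
        unfolding diff_Suc_1 e by (simp add: algebra_simps)
      then show ?thesis using 3 Suc by blast
    qed
  next
    case (4 m)
    define P where "P = (- b) ^ m * pochhammer (s + of_nat k) m"
    have p1: "pochhammer (s + of_nat k) (Suc m) = pochhammer (s + of_nat k) m * (s + of_nat n - 1)"
      using 4 by (simp add: pochhammer_Suc algebra_simps)
    have p2: "pochhammer (s + of_nat k) (Suc (Suc m)) =
        pochhammer (s + of_nat k) m * (s + of_nat n - 1) * (s + of_nat n)"
      using 4 by (simp add: pochhammer_Suc algebra_simps)
    have a1: "A n k = of_nat (n choose k) * (- b) * (s + of_nat n - 1) * P"
      using 4 p1 unfolding A_def meixner_coeff_def P_def by (simp add: Suc_diff_le)
    have a2: "A (Suc n) k = of_nat (Suc n choose k) * b\<^sup>2 * (s + of_nat n - 1) * (s + of_nat n) * P"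
      using 4 p2 unfolding A_def meixner_coeff_def P_def
      by (simp add: Suc_diff_le power2_eq_square del: binomial_Suc_Suc)
    have a3: "A (n - 1) k = of_nat ((n - 1) choose k) * P"
      using 4 unfolding A_def meixner_coeff_def P_def by simp
    have "of_nat (n - k) * of_nat (n choose k) = (of_nat n * of_nat ((n - 1) choose k) :: complex)"
      using binomial_absorb_comp[of n k] by (metis of_nat_mult)
    then have c2: "(of_nat n - of_nat k) * of_nat (n choose k) = (of_nat n * of_nat ((n - 1) choose k) :: complex)"
      using 4 by (simp add: of_nat_diff del: binomial_Suc_Suc)
    show ?thesis
    proof (cases k)
      case 0
      then show ?thesis unfolding a1 a2 a3 by (simp add: power2_eq_square algebra_simps)
    next
      case (Suc j)
      have p3: "pochhammer (s + of_nat j) (Suc (Suc m)) =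
          (s + of_nat j) * pochhammer (s + of_nat k) m * (s + of_nat n - 1)"
        unfolding pochhammer_rec[of _ "Suc m"] using p1 Suc by (simp add: add_ac)
      have a4: "A n j = of_nat (n choose j) * b\<^sup>2 * (s + of_nat j) * (s + of_nat n - 1) * P"
        using 4 p3 Suc unfolding A_def meixner_coeff_def P_def
        by (simp add: Suc_diff_le power2_eq_square del: binomial_Suc_Suc)
      define B C D where "B = (of_nat (n choose k) :: complex)"
        and "C = (of_nat (n choose j) :: complex)" and "D = (of_nat ((n-1) choose k) :: complex)"
      have c1: "of_nat (Suc n choose k) = C + B"
        using Suc by (simp add: B_def C_def)
      have "Suc j * (n choose Suc j) = (n - j) * (n choose j)"
        by (metis binomial_absorb_comp binomial_absorption)
      then have "of_nat (Suc j) * of_nat (n choose Suc j) = (of_nat (n - j) * of_nat (n choose j) :: complex)"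
        by (metis of_nat_mult)
      then have c3: "of_nat k * B = (of_nat n - of_nat k + 1) * C"
        using Suc 4 by (simp add: B_def C_def of_nat_diff del: binomial_Suc_Suc)
      have c2': "(of_nat n - of_nat k) * B = of_nat n * D"
        using c2 by (simp add: B_def D_def)
      define N K where "N = (of_nat n :: complex)" and "K = (of_nat k :: complex)"
      have j: "of_nat j = K - 1" using Suc by (simp add: K_def)
      have kk: "k \<noteq> 0" "k - 1 = j" using Suc by auto
      let ?L = "C * b\<^sup>2 * (s + (K - 1)) * (s + N - 1) * P + K * (a - b) * (B * (- b) * (s + N - 1) * P)"
      let ?R = "(C + B) * b\<^sup>2 * (s + N - 1) * (s + N) * P + ((a + b) * N + s * b) * (B * (- b) * (s + N - 1) * P)
          + a * b * N * (s + N - 1) * (D * P)"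
      \<comment> \<open>Once the common factor is removed, s cancels and the rest is linear in a and
        b. Its two coefficients vanish by the absorption identities k C(n,k) = (n-k+1) C(n,k-1) and
        (n-k) C(n,k) = n C(n-1,k).\<close>
      have "?L - ?R = b * P * (s + N - 1) * (b * (K * B - (N - K + 1) * C) + a * ((N - K) * B - N * D))"
        by (simp add: algebra_simps power2_eq_square)
      also have "\<dots> = 0"
        using c3 c2' by (simp add: N_def K_def)
      finally have "?L = ?R" by simp
      then show ?thesis unfolding a1 a2 a3 kk a4 c1 if_not_P[OF kk(1)] j
        by (simp only: N_def K_def B_def C_def D_def kk if_False)
    qed
  qed
qed

text \<open>The Pochhammer factors and powers of b combine to the same product for every k, leaving
  the alternating binomial sum (1-1)^n. Hence the values b^k s(s+1)...(s+k-1) solve the triangular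
  system that \<open>\<Phi> (p n) = 0\<close> imposes.\<close>

lemma meixner_coeff_pochhammer_sum:
  assumes "n \<ge> 1"
  shows "(\<Sum>k\<le>n. meixner_coeff b s n k * (b ^ k * pochhammer s k)) = 0"
proof -
  have "(\<Sum>k\<le>n. meixner_coeff b s n k * (b ^ k * pochhammer s k))
      = (\<Sum>k\<le>n. b ^ n * pochhammer s n * (of_nat (n choose k) * 1 ^ k * (-1) ^ (n - k)))"
  proof (intro sum.cong refl)
    fix k assume "k \<in> {..n}"
    then have k: "k \<le> n" by simp
    have "b ^ k * (- b) ^ (n - k) = b ^ n * (- 1) ^ (n - k)"
      using k by (simp add: power_minus[of b] flip: power_add)
    moreover have "pochhammer s k * pochhammer (s + of_nat k) (n - k) = pochhammer s n"
      using pochhammer_product[OF k, of s] by simp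
    moreover have "meixner_coeff b s n k * (b ^ k * pochhammer s k)
      = of_nat (n choose k) * (b ^ k * (- b) ^ (n - k)) * (pochhammer s k * pochhammer (s + of_nat k) (n - k))"
      unfolding meixner_coeff_def by (simp only: mult_ac)
    ultimately show "meixner_coeff b s n k * (b ^ k * pochhammer s k)
      = b ^ n * pochhammer s n * (of_nat (n choose k) * 1 ^ k * (-1) ^ (n - k))"
      by (simp only: power_one mult_1_left mult_1_right mult_ac)
  qed
  also have "\<dots> = b ^ n * pochhammer s n * (1 + (-1)) ^ n"
    unfolding binomial_ring by (simp add: sum_distrib_left)
  finally show ?thesis using assms by simp
qed

lemma smult_sum_right: "smult c (\<Sum>i\<in>A. f i) = (\<Sum>i\<in>A. smult c (f i))"
  by (induction A rule: infinite_finite_induct) (simp_all add: smult_add_right)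

lemma meixner_poly_expansion:
  fixes p :: "nat \<Rightarrow> complex poly" and a b s :: complex
  defines "Q \<equiv> \<lambda>k. \<Prod>i<k. [:0, 1:] - of_nat i * [:a - b:]"
  assumes p0: "p 0 = 1"
    and rec: "\<And>n. [:0, 1:] * p n = p (Suc n) + smult ((a + b) * of_nat n + s * b) (p n)
           + smult (a * b * of_nat n * (s + of_nat n - 1)) (p (n - 1))"
  shows "p n = (\<Sum>k\<le>n. smult (meixner_coeff b s n k) (Q k))"
proof -
  define A where "A = meixner_coeff b s"
  define P where "P n = (\<Sum>k\<le>n. smult (A n k) (Q k))" for n
  \<comment> \<open>Padding with the zero entries above the diagonal gives three consecutive
    polynomials a common summation range.\<close>
  have P_eq: "P n = (\<Sum>k\<le>m. smult (A n k) (Q k))" if "n \<le> m" for n m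
    unfolding P_def using that
    by (intro sum.mono_neutral_left) (auto simp: A_def meixner_coeff_eq_0)
  have XQ: "[:0, 1:] * Q k = Q (Suc k) + smult (of_nat k * (a - b)) (Q k)" for k
  proof -
    have "of_nat k * [:a - b:] = [:of_nat k * (a - b):]"
      by (simp add: of_nat_poly)
    then have "Q (Suc k) = Q k * ([:0, 1:] - [:of_nat k * (a - b):])"
      by (simp add: Q_def del: diff_pCons)
    also have "\<dots> = [:0, 1:] * Q k - smult (of_nat k * (a - b)) (Q k)"
      unfolding right_diff_distrib by (simp add: mult.commute[of "Q k"])
    finally show ?thesis by simp
  qed
  have P_rec: "[:0, 1:] * P n = P (Suc n) + smult ((a + b) * of_nat n + s * b) (P n)
           + smult (a * b * of_nat n * (s + of_nat n - 1)) (P (n - 1))" for n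
  proof -
    have "[:0, 1:] * P n = (\<Sum>k\<le>n. smult (A n k) ([:0, 1:] * Q k))"
      unfolding P_def sum_distrib_left by simp
    also have "\<dots> = (\<Sum>k\<le>n. smult (A n k) (Q (Suc k))) + (\<Sum>k\<le>n. smult (of_nat k * (a - b) * A n k) (Q k))"
      unfolding XQ by (simp add: smult_add_right sum.distrib mult_ac)
    also have "(\<Sum>k\<le>n. smult (A n k) (Q (Suc k))) = (\<Sum>k\<le>Suc n. smult (if k = 0 then 0 else A n (k - 1)) (Q k))"
      by (subst sum.atMost_Suc_shift) simp
    also have "(\<Sum>k\<le>n. smult (of_nat k * (a - b) * A n k) (Q k)) = (\<Sum>k\<le>Suc n. smult (of_nat k * (a - b) * A n k) (Q k))"
      by (simp add: A_def meixner_coeff_eq_0)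
    also have "(\<Sum>k\<le>Suc n. smult (if k = 0 then 0 else A n (k - 1)) (Q k)) + \<dots>
      = (\<Sum>k\<le>Suc n. smult ((if k = 0 then 0 else A n (k - 1)) + of_nat k * (a - b) * A n k) (Q k))"
      by (simp only: smult_add_left sum.distrib)
    also have "\<dots> = (\<Sum>k\<le>Suc n. smult (A (Suc n) k + ((a + b) * of_nat n + s * b) * A n k
      + a * b * of_nat n * (s + of_nat n - 1) * A (n - 1) k) (Q k))"
      unfolding A_def meixner_coeff_recurrence ..
    also have "\<dots> = P (Suc n) + smult ((a + b) * of_nat n + s * b) (P n)
           + smult (a * b * of_nat n * (s + of_nat n - 1)) (P (n - 1))"
      unfolding P_eq[of _ "Suc n", OF order_refl] P_eq[of n "Suc n", OF le_SucI[OF order_refl]]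
        P_eq[of "n - 1" "Suc n", OF le_SucI[OF diff_le_self]]
      by (simp only: smult_add_left sum.distrib smult_smult smult_sum_right)
    finally show ?thesis .
  qed
  \<comment> \<open>The recurrence has order two, so the induction carries two neighbouring indices.
    At n = 0 both are index 0, which suffices because p (n - 1) then has coefficient 0.\<close>
  have "p n = P n \<and> p (n - 1) = P (n - 1)"
  proof (induction n)
    case 0
    then show ?case using p0 by (simp add: P_def A_def meixner_coeff_def Q_def)
  next
    case (Suc n)
    then show ?case using rec[of n] P_rec[of n] by simp
  qed
  then show ?thesis by (simp add: P_def A_def)
qed

text \<open>The matrix of coefficients is unitriangular, so \<open>\<Phi> (p n) = 0\<close>
  determines the n-th factorial moment from the lower ones. The claimed values satisfy the same
  equations, and strong induction concludes.\<close>

lemma meixner_functional_gen_ffact: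
  fixes p :: "nat \<Rightarrow> complex poly" and \<Phi> :: "complex poly \<Rightarrow> complex" and a b s :: complex
  assumes p0: "p 0 = 1"
    and rec: "\<And>n. [:0, 1:] * p n = p (Suc n) + smult ((a + b) * of_nat n + s * b) (p n)
           + smult (a * b * of_nat n * (s + of_nat n - 1)) (p (n - 1))"
    and lin: "Vector_Spaces.linear smult (*) \<Phi>"
    and \<Phi>1: "\<Phi> 1 = 1" and \<Phi>p: "\<And>n. n \<ge> 1 \<Longrightarrow> \<Phi> (p n) = 0"
  shows "\<Phi> (\<Prod>i<k. [:0, 1:] - of_nat i * [:a - b:]) = gen_ffact (s * b) (- b) k"
proof -
  interpret \<Phi>: Vector_Spaces.linear smult "(*)" \<Phi> by fact
  define Q where "Q k = (\<Prod>i<k. [:0, 1:] - of_nat i * [:a - b:])" for k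
  have "\<Phi> (Q k) = b ^ k * pochhammer s k"
  proof (induction k rule: less_induct)
    case (less n)
    show ?case
    proof (cases "n = 0")
      case True
      then show ?thesis using \<Phi>1 by (simp add: Q_def)
    next
      case False
      let ?A = "meixner_coeff b s n"
      have "0 = \<Phi> (p n)" using \<Phi>p False by simp
      also have "\<dots> = (\<Sum>k\<le>n. ?A k * \<Phi> (Q k))"
        unfolding meixner_poly_expansion[of p, OF p0 rec] Q_def[symmetric] by (simp add: \<Phi>.sum \<Phi>.scale)
      also have "\<dots> = \<Phi> (Q n) + (\<Sum>k<n. ?A k * \<Phi> (Q k))"
        unfolding lessThan_Suc_atMost[symmetric] by (simp add: meixner_coeff_def)
      also have "(\<Sum>k<n. ?A k * \<Phi> (Q k)) = (\<Sum>k<n. ?A k * (b ^ k * pochhammer s k))"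
        by (intro sum.cong) (auto simp: less)
      also have "\<dots> = (\<Sum>k\<le>n. ?A k * (b ^ k * pochhammer s k)) - b ^ n * pochhammer s n"
        unfolding lessThan_Suc_atMost[symmetric] by (simp add: meixner_coeff_def)
      also have "\<dots> = - (b ^ n * pochhammer s n)"
        using meixner_coeff_pochhammer_sum[of n b s] False by simp
      finally show ?thesis by simp
    qed
  qed
  then show ?thesis by (simp add: Q_def gen_ffact_uminus_eq_pochhammer)
qed

text \<open>The Stirling identity holds in any commutative ring and is used here in the polynomial
  ring with the constant polynomial \<open>[:d:]\<close> as step. Constants are then turned into
  scalars so that linearity of \<open>\<Phi>\<close> applies.\<close>

lemma functional_power_eq_sum_Stirling:
  assumes lin: "Vector_Spaces.linear smult (*) \<Phi>"
    and \<Phi>: "\<And>k. \<Phi> (\<Prod>i<k. [:0, 1:] - of_nat i * [:d:]) = x k"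
    and n: "n \<ge> 1"
  shows "\<Phi> ([:0, 1:] ^ n) = (\<Sum>k=1..n. d ^ (n - k) * of_nat (Stirling n k) * (x k :: complex))"
proof -
  interpret \<Phi>: Vector_Spaces.linear smult "(*)" \<Phi> by fact
  have *: "[:d:] ^ (n - k) * of_nat (Stirling n k) * q = smult (d ^ (n - k) * of_nat (Stirling n k)) q" for k and q :: "complex poly"
    by (simp add: of_nat_poly poly_const_pow)
  show ?thesis
    unfolding power_eq_sum_Stirling[of "[:0, 1:]" n "[:d:]"] *
    by (simp only: \<Phi>.sum \<Phi>.scale \<Phi> sum_Stirling_from_1[OF n])
qed

lemma has_bochner_integral_power_if_gen_ffact:
  fixes f :: "'a \<Rightarrow> complex"
  assumes "\<And>k. has_bochner_integral M (\<lambda>x. gen_ffact (f x) d k) (m k)" and n: "n \<ge> 1"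
  shows "has_bochner_integral M (\<lambda>x. f x ^ n) (\<Sum>k=1..n. d ^ (n - k) * of_nat (Stirling n k) * m k)"
proof -
  have "(\<lambda>x. f x ^ n) = (\<lambda>x. \<Sum>k=1..n. d ^ (n - k) * of_nat (Stirling n k) * gen_ffact (f x) d k)"
    unfolding gen_ffact_def power_eq_sum_Stirling[of _ n d]
    by (rule ext) (rule sum_Stirling_from_1[OF n])
  then show ?thesis
    by (auto intro!: has_bochner_integral_sum has_bochner_integral_mult_right assms)
qed

subsection \<open>Gamma integrals\<close>

text \<open>Euler's integral under t = e^y. On the whole line the imaginary part of z enters as a
  Fourier frequency, the form needed for Parseval's identity.\<close>

lemma has_bochner_integral_Gamma_exp:
  assumes z: "Re z > 0"
  shows "has_bochner_integral lborel (\<lambda>y. exp (z * of_real y - of_real (exp y))) (Gamma z)"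
proof -
  define f where "f t = complex_of_real t powr (z - 1) / of_real (exp t)" for t
  define h where "h y = exp (z * of_real y - of_real (exp y))" for y :: real
  have img: "exp ` (UNIV :: real set) = {0<..}"
    by (auto simp: image_iff) (metis exp_ln)
  have eq: "\<bar>exp y\<bar> *\<^sub>R f (exp y) = h y" for y :: real
    by (simp add: f_def h_def scaleR_conv_of_real powr_def Ln_of_real exp_diff left_diff_distrib
        flip: exp_of_real)
  have "f absolutely_integrable_on exp ` UNIV \<and> integral (exp ` UNIV) f = Gamma z"
    unfolding img f_def
    using absolutely_integrable_Gamma_integral'[OF z] Gamma_integral_complex'[OF z]
    by (auto intro: integral_unique)
  then have *: "h absolutely_integrable_on UNIV \<and> integral UNIV h = Gamma z"
    using has_absolute_integral_change_of_variables_real[of UNIV exp exp f "Gamma z"]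
    unfolding eq by (auto intro!: derivative_eq_intros simp: inj_on_def)
  \<comment> \<open>The change of variables gives integrability for the completed Lebesgue measure;
    Borel measurability brings it back to \<open>lborel\<close>.\<close>
  have "h \<in> borel_measurable borel"
    unfolding h_def by (intro borel_measurable_continuous_onI continuous_intros)
  then have "integrable lborel h"
    using * by (simp add: set_integrable_def integrable_completion)
  then show ?thesis
    using * integral_lborel[of h] unfolding h_def has_bochner_integral_iff by simp
qed

lemma has_bochner_integral_Gamma_exp_real:
  assumes x: "x > (0::real)"
  shows "has_bochner_integral lborel (\<lambda>y. exp (x * y - exp y)) (Gamma x)"
proof -
  have "has_bochner_integral lborel (\<lambda>y. Re (exp (of_real x * of_real y - of_real (exp y)))) (Re (Gamma (of_real x)))"
    using has_bochner_integral_Gamma_exp[of "of_real x"] x by (intro has_bochner_integral_Re) simp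
  moreover have "Re (exp (of_real x * of_real y - of_real (exp y))) = exp (x * y - exp y)" for y
    by (simp add: exp_of_real flip: of_real_mult of_real_diff)
  ultimately show ?thesis by (simp add: Gamma_complex_of_real)
qed

lemma Gamma_plus_of_nat:
  fixes z :: "'a::Gamma"
  assumes "z \<notin> \<int>\<^sub>\<le>\<^sub>0"
  shows "Gamma (z + of_nat n) = Gamma z * pochhammer z n"
  using pochhammer_Gamma[OF assms, of n] assms by (simp add: Gamma_eq_zero_iff)

text \<open>
  Termwise integration of $e^{-wx} = e^{-x} \sum_n (1-w)^n x^n / n!$ against $x^{z-1}$ yields a
  binomial series for $w^{-z}$. Rescaling $x$ by a suitable positive factor moves any $w$ in the
  right half-plane into the disc $|1-w| < 1$.
\<close>

lemma has_bochner_integral_Gamma_exp_near_1: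
  assumes z: "Re z > 0" and w: "norm (1 - w) < 1"
  shows "has_bochner_integral lborel (\<lambda>y. exp (z * of_real y - w * of_real (exp y))) (Gamma z * w powr - z)"
proof -
  define f where "f n y = (1 - w) ^ n / fact n * exp ((z + of_nat n) * of_real y - of_real (exp y))"
    for n :: nat and y :: real
  have f: "has_bochner_integral lborel (f n) ((1 - w) ^ n / fact n * Gamma (z + of_nat n))" for n
    unfolding f_def using z by (intro has_bochner_integral_mult_right has_bochner_integral_Gamma_exp) auto
  have norm_f: "norm (f n y) = norm (1 - w) ^ n / fact n * exp ((Re z + real n) * y - exp y)" for n y
    by (simp add: f_def norm_mult norm_divide norm_power)
  have int_norm_f: "(LINT y|lborel. norm (f n y)) = norm (1 - w) ^ n / fact n * Gamma (Re z + real n)" for n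
    unfolding norm_f using z
    by (intro has_bochner_integral_integral_eq has_bochner_integral_mult_right has_bochner_integral_Gamma_exp_real) auto
  have f_eq: "f n y = exp (z * of_real y - of_real (exp y)) * (((1 - w) * of_real (exp y)) ^ n /\<^sub>R fact n)" for n y
  proof -
    have "exp ((z + of_nat n) * of_real y - of_real (exp y))
      = exp (z * of_real y - of_real (exp y) + of_nat n * of_real y)"
      by (simp add: algebra_simps)
    also have "\<dots> = exp (z * of_real y - of_real (exp y)) * of_real (exp y) ^ n"
      unfolding exp_add exp_of_nat_mult exp_of_real ..
    finally show ?thesis
      unfolding f_def by (simp add: power_mult_distrib scaleR_conv_of_real divide_inverse mult_ac)
  qed
  have f_sums: "(\<lambda>n. f n y) sums exp (z * of_real y - w * of_real (exp y))" for y
  proof -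
    have "(\<lambda>n. exp (z * of_real y - of_real (exp y)) * (((1 - w) * of_real (exp y)) ^ n /\<^sub>R fact n))
        sums (exp (z * of_real y - of_real (exp y)) * exp ((1 - w) * of_real (exp y)))"
      by (intro sums_mult exp_converges)
    moreover have "exp (z * of_real y - of_real (exp y)) * exp ((1 - w) * of_real (exp y))
        = exp (z * of_real y - w * of_real (exp y))"
      by (simp add: algebra_simps flip: exp_add)
    ultimately show ?thesis unfolding f_eq by simp
  qed
  have "norm (f n y) = norm (exp (z * of_real y - of_real (exp y))) * ((norm (1 - w) * exp y) ^ n /\<^sub>R fact n)" for n y
    unfolding f_eq norm_mult by (simp add: norm_power norm_mult)
  then have summable_f: "summable (\<lambda>n. norm (f n y))" for y
    by (simp only: summable_mult exp_converges[THEN sums_summable])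
  \<comment> \<open>The L1 norms of the terms again form a binomial series, with Re z and |1-w| in
    place of z and 1-w. It converges since |1-w| < 1, which justifies termwise integration.\<close>
  have summable_int: "summable (\<lambda>n. LINT y|lborel. norm (f n y))"
  proof -
    have "(\<lambda>n. (- Re z gchoose n) * (- norm (1 - w)) ^ n) sums (1 + - norm (1 - w)) powr - Re z"
      using w by (intro gen_binomial_real) simp
    then have "summable (\<lambda>n. Gamma (Re z) * ((- Re z gchoose n) * (- norm (1 - w)) ^ n))"
      by (intro summable_mult) (rule sums_summable)
    moreover have "Gamma (Re z) * ((- Re z gchoose n) * (- norm (1 - w)) ^ n) = (LINT y|lborel. norm (f n y))" for n
    proof -
      have "Re z \<notin> \<int>\<^sub>\<le>\<^sub>0" using z by (auto elim!: nonpos_Ints_cases)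
      then show ?thesis
        unfolding int_norm_f by (simp add: Gamma_plus_of_nat gbinomial_pochhammer power_minus[of "norm _"])
    qed
    ultimately show ?thesis by simp
  qed
  have "(\<lambda>n. (- z gchoose n) * (w - 1) ^ n) sums (1 + (w - 1)) powr - z"
    using w by (intro gen_binomial_complex) (simp add: norm_minus_commute)
  then have "(\<lambda>n. Gamma z * ((- z gchoose n) * (w - 1) ^ n)) sums (Gamma z * w powr - z)"
    by (intro sums_mult) simp
  moreover have "Gamma z * ((- z gchoose n) * (w - 1) ^ n) = (LINT y|lborel. f n y)" for n
  proof -
    have "z \<notin> \<int>\<^sub>\<le>\<^sub>0" using z by (auto elim!: nonpos_Ints_cases)
    moreover have "(w - 1) ^ n = (-1) ^ n * (1 - w) ^ n"
      by (simp flip: power_mult_distrib)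
    ultimately show ?thesis
      unfolding has_bochner_integral_integral_eq[OF f]
      by (simp add: Gamma_plus_of_nat gbinomial_pochhammer)
  qed
  ultimately have 1: "(\<lambda>n. LINT y|lborel. f n y) sums (Gamma z * w powr - z)" by simp
  have int_f: "integrable lborel (f n)" for n using f by (auto simp: has_bochner_integral_iff)
  have "(\<lambda>n. LINT y|lborel. f n y) sums (LINT y|lborel. (\<Sum>n. f n y))"
    by (rule sums_integral[OF int_f _ summable_int]) (simp add: summable_f)
  then have "(LINT y|lborel. (\<Sum>n. f n y)) = Gamma z * w powr - z"
    using 1 sums_unique2 by blast
  moreover have "integrable lborel (\<lambda>y. (\<Sum>n. f n y))"
    by (rule integrable_suminf[OF int_f _ summable_int]) (simp add: summable_f)
  ultimately show ?thesis
    by (simp add: has_bochner_integral_iff sums_unique[OF f_sums, symmetric])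
qed

lemma has_bochner_integral_Gamma_exp_right_halfplane:
  assumes z: "Re z > 0" and w: "Re w > 0"
  shows "has_bochner_integral lborel (\<lambda>y. exp (z * of_real y - w * of_real (exp y))) (Gamma z * w powr - z)"
proof -
  \<comment> \<open>This r minimises |1 - r w| over real r; the minimal square is 1 - (Re w)^2 /
    |w|^2, which is below 1 exactly when Re w is nonzero.\<close>
  define r where "r = Re w / (norm w)\<^sup>2"
  have w0: "w \<noteq> 0" using w by auto
  then have r: "r > 0" using w by (simp add: r_def)
  have "(norm (1 - of_real r * w))\<^sup>2 = 1 - 2 * r * Re w + r * (r * (norm w)\<^sup>2)"
    unfolding cmod_power2 by (simp add: power2_eq_square algebra_simps)
  also have "r * (norm w)\<^sup>2 = Re w" using w0 by (simp add: r_def)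
  also have "1 - 2 * r * Re w + r * Re w = 1 - r * Re w" by simp
  also have "\<dots> < 1\<^sup>2" using r w by simp
  finally have "norm (1 - of_real r * w) < 1"
    by (rule power2_less_imp_less) simp
  note * = has_bochner_integral_Gamma_exp_near_1[OF z this]
  have "has_bochner_integral lborel (\<lambda>y. exp (z * of_real (ln r)) * exp (z * of_real y - of_real r * w * of_real (exp y)))
     (exp (z * of_real (ln r)) * (Gamma z * (of_real r * w) powr - z))"
    by (intro has_bochner_integral_mult_right *)
  moreover have "exp (z * of_real (ln r)) * exp (z * of_real y - of_real r * w * of_real (exp y))
    = exp (z * of_real (ln r + 1 * y) - w * of_real (exp (ln r + 1 * y)))" for y
  proof -
    have "exp (ln r + 1 * y) = r * exp y" using r by (simp add: exp_add)
    then show ?thesis by (simp add: algebra_simps flip: exp_add)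
  qed
  \<comment> \<open>Scaling by a positive real only adds ln r to the principal logarithm, so the
    power splits without a branch correction and the factors r^z and r^(-z) cancel.\<close>
  moreover have "exp (z * of_real (ln r)) * (Gamma z * (of_real r * w) powr - z) = Gamma z * w powr - z"
  proof -
    have "Ln (of_real r * w) = of_real (ln r) + Ln w"
      using r w0 by (simp add: Ln_times_of_real Ln_of_real)
    then show ?thesis
      using r w0 by (simp add: powr_def algebra_simps flip: exp_add)
  qed
  ultimately have "has_bochner_integral lborel (\<lambda>y. exp (z * of_real (ln r + 1 * y) - w * of_real (exp (ln r + 1 * y))))
    (Gamma z * w powr - z)" by simp
  then show ?thesis
    using lborel_has_bochner_integral_real_affine_iff[of 1 "\<lambda>y. exp (z * of_real y - w * of_real (exp y))" _ "ln r"]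
    by simp
qed

subsection \<open>Parseval's identity\<close>

text \<open>Fubini applies because the exponential has modulus 1. The sign parameter c covers both
  the Fourier transform (c = 1) and its conjugate (c = -1).\<close>

lemma integral_iexp_multiplication_formula:
  fixes f h :: "real \<Rightarrow> complex"
  assumes f: "integrable lborel f" and h: "integrable lborel h"
  shows "(LINT t|lborel. (LINT y|lborel. f y * iexp (c * t * y)) * h t)
    = (LINT y|lborel. f y * (LINT t|lborel. h t * iexp (c * t * y)))"
proof -
  have [measurable]: "f \<in> borel_measurable lborel" "h \<in> borel_measurable lborel"
    using f h by auto
  have "integrable (lborel \<Otimes>\<^sub>M lborel) (\<lambda>(y, t). f y * iexp (c * t * y) * h t)"
  proof (rule lborel_pair.Fubini_integrable)
    show "integrable lborel (\<lambda>y. LINT t|lborel. norm (case (y, t) of (y, t) \<Rightarrow> f y * iexp (c * t * y) * h t))"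
      using f h by (simp add: norm_mult)
    show "AE y in lborel. integrable lborel (\<lambda>t. case (y, t) of (y, t) \<Rightarrow> f y * iexp (c * t * y) * h t)"
    proof (intro AE_I2)
      fix y
      have "integrable lborel (\<lambda>t. f y * h t)" using h by simp
      then show "integrable lborel (\<lambda>t. case (y, t) of (y, t) \<Rightarrow> f y * iexp (c * t * y) * h t)"
        by (rule Bochner_Integration.integrable_bound) (auto simp: norm_mult)
    qed
  qed measurable
  from lborel_pair.Fubini_integral[OF this]
  have "(LINT t|lborel. LINT y|lborel. f y * iexp (c * t * y) * h t)
      = (LINT y|lborel. LINT t|lborel. f y * (h t * iexp (c * t * y)))"
    by (simp add: mult_ac)
  then show ?thesis by simp
qed

text \<open>This is the characteristic function of the standard normal distribution at v/e, after
  the substitution x = e t.\<close>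

lemma integral_Gaussian_iexp:
  fixes e v :: real
  assumes e: "e > 0"
  shows "has_bochner_integral lborel (\<lambda>t. complex_of_real (exp (- (e * t)\<^sup>2 / 2)) * iexp (t * v))
    (complex_of_real (sqrt (2 * pi) / e * exp (- (v / e)\<^sup>2 / 2)))"
proof -
  interpret N: real_distribution std_normal_distribution by (rule real_dist_normal_dist)
  have "has_bochner_integral std_normal_distribution (\<lambda>x. iexp (v / e * x)) (char std_normal_distribution (v / e))"
    unfolding char_def by (intro has_bochner_integral_integrable N.integrable_iexp) auto
  then have "has_bochner_integral lborel (\<lambda>x. std_normal_density x *\<^sub>R iexp (v / e * x))
      (char std_normal_distribution (v / e))"
    by (simp add: has_bochner_integral_iff integrable_density integral_density)
  then have "has_bochner_integral lborel (\<lambda>t. std_normal_density (0 + e * t) *\<^sub>R iexp (v / e * (0 + e * t)))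
      (char std_normal_distribution (v / e) /\<^sub>R \<bar>e\<bar>)"
    using e by (subst (asm) lborel_has_bochner_integral_real_affine_iff[of e _ _ 0]) auto
  then have "has_bochner_integral lborel
      (\<lambda>t. complex_of_real (sqrt (2 * pi)) * (std_normal_density (0 + e * t) *\<^sub>R iexp (v / e * (0 + e * t))))
      (complex_of_real (sqrt (2 * pi)) * (char std_normal_distribution (v / e) /\<^sub>R \<bar>e\<bar>))"
    by (intro has_bochner_integral_mult_right)
  moreover have "complex_of_real (sqrt (2 * pi)) * (std_normal_density (0 + e * t) *\<^sub>R iexp (v / e * (0 + e * t)))
     = complex_of_real (exp (- (e * t)\<^sup>2 / 2)) * iexp (t * v)" for t
    using e by (simp add: std_normal_density_def scaleR_conv_of_real mult_ac)
  moreover have "complex_of_real (sqrt (2 * pi)) * (char std_normal_distribution (v / e) /\<^sub>R \<bar>e\<bar>)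
     = complex_of_real (sqrt (2 * pi) / e * exp (- (v / e)\<^sup>2 / 2))"
    using e by (simp add: char_std_normal_distribution scaleR_conv_of_real field_simps)
  ultimately show ?thesis by simp
qed

text \<open>Positive sign and no normalisation, as for characteristic functions: transforming exp(p
  y - w e^y) then gives the Gamma integral at p + it directly, and Parseval's identity carries the
  factor 2 pi.\<close>

definition fourier :: "(real \<Rightarrow> complex) \<Rightarrow> real \<Rightarrow> complex" where
  "fourier f t = (LINT y|lborel. f y * iexp (t * y))"

lemma fourier_measurable [measurable]:
  assumes [measurable]: "f \<in> borel_measurable borel"
  shows "fourier f \<in> borel_measurable borel"
  unfolding fourier_def by measurable

lemma norm_fourier_le: "norm (fourier f t) \<le> (LINT y|lborel. norm (f y))"
  unfolding fourier_def
  by (rule order_trans[OF integral_norm_bound]) (simp add: norm_mult)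

lemma borel_measurable_cnj [measurable]: "cnj \<in> borel_measurable borel"
  by (intro borel_measurable_continuous_onI continuous_intros)

lemma cnj_fourier: "cnj (fourier g t) = (LINT y|lborel. cnj (g y) * iexp (- t * y))"
  unfolding fourier_def Bochner_Integration.integral_cnj[symmetric]
  by (rule Bochner_Integration.integral_cong) (simp_all add: exp_cnj)

text \<open>A smoothed Fourier inversion. The multiplication formula moves the transform onto the
  Gaussian, whose transform is a Gaussian of width e around x; substituting y = x + e v exhibits an
  approximate identity as e tends to 0.\<close>

lemma integral_fourier_Gaussian:
  fixes f :: "real \<Rightarrow> complex"
  assumes f: "integrable lborel f" and e: "e > 0"
  shows "(LINT t|lborel. fourier f t * (of_real (exp (- (e * t)\<^sup>2 / 2)) * iexp (- t * x)))
    = of_real (sqrt (2 * pi)) * (LINT v|lborel. f (x + e * v) * of_real (exp (- v\<^sup>2 / 2)))"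
proof -
  let ?h = "\<lambda>t. of_real (exp (- (e * t)\<^sup>2 / 2)) * iexp (- t * x)"
  have h: "integrable lborel ?h"
    using integral_Gaussian_iexp[OF e, of "- x"] by (simp add: has_bochner_integral_iff)
  have "(LINT t|lborel. fourier f t * ?h t) = (LINT y|lborel. f y * (LINT t|lborel. ?h t * iexp (t * y)))"
    using integral_iexp_multiplication_formula[OF f h, of 1] by (simp add: fourier_def)
  also have "(\<lambda>y. LINT t|lborel. ?h t * iexp (t * y))
      = (\<lambda>y. of_real (sqrt (2 * pi) / e * exp (- ((y - x) / e)\<^sup>2 / 2)))"
  proof
    fix y
    have "?h t * iexp (t * y) = of_real (exp (- (e * t)\<^sup>2 / 2)) * iexp (t * (y - x))" for t
      by (simp add: mult.assoc algebra_simps flip: exp_add)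
    then show "(LINT t|lborel. ?h t * iexp (t * y))
      = of_real (sqrt (2 * pi) / e * exp (- ((y - x) / e)\<^sup>2 / 2))"
      using has_bochner_integral_integral_eq[OF integral_Gaussian_iexp[OF e, of "y - x"]] by (simp only:)
  qed
  also have "(LINT y|lborel. f y * of_real (sqrt (2 * pi) / e * exp (- ((y - x) / e)\<^sup>2 / 2)))
      = e *\<^sub>R (LINT v|lborel. f (x + e * v) * of_real (sqrt (2 * pi) / e * exp (- v\<^sup>2 / 2)))"
    using e by (subst lborel_integral_real_affine[of e _ x]) auto
  also have "(\<lambda>v. f (x + e * v) * of_real (sqrt (2 * pi) / e * exp (- v\<^sup>2 / 2)))
      = (\<lambda>v. of_real (sqrt (2 * pi) / e) * (f (x + e * v) * of_real (exp (- v\<^sup>2 / 2))))"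
    by (simp add: fun_eq_iff)
  finally show ?thesis
    using e by (simp add: scaleR_conv_of_real)
qed

text \<open>The transform of f is bounded but not known to be integrable; times the Gaussian it is.
  So the multiplication formula can unfold the conjugate transform of g, leaving the smoothed
  inversion of f inside.\<close>

lemma integral_fourier_cnj_fourier_Gaussian:
  fixes f g :: "real \<Rightarrow> complex"
  assumes f: "integrable lborel f" and g: "integrable lborel g" and e: "e > 0"
  shows "(LINT t|lborel. fourier f t * cnj (fourier g t) * of_real (exp (- (e * t)\<^sup>2 / 2)))
    = of_real (sqrt (2 * pi)) *
      (LINT x|lborel. cnj (g x) * (LINT v|lborel. f (x + e * v) * of_real (exp (- v\<^sup>2 / 2))))"
proof -
  let ?G = "\<lambda>t. complex_of_real (exp (- (e * t)\<^sup>2 / 2))"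
  have [measurable]: "f \<in> borel_measurable lborel" using f by auto
  have "integrable lborel ?G"
    using integral_Gaussian_iexp[OF e, of 0] by (simp add: has_bochner_integral_iff)
  then have "integrable lborel (\<lambda>t. (LINT y|lborel. norm (f y)) *\<^sub>R ?G t)"
    by (intro integrable_scaleR_right)
  then have h: "integrable lborel (\<lambda>t. fourier f t * ?G t)"
    by (rule Bochner_Integration.integrable_bound)
       (auto simp: norm_mult intro!: AE_I2 mult_right_mono norm_fourier_le order_trans[OF norm_fourier_le])
  have g': "integrable lborel (\<lambda>y. cnj (g y))" using g by simp
  have "(LINT t|lborel. fourier f t * cnj (fourier g t) * ?G t)
     = (LINT t|lborel. (LINT y|lborel. cnj (g y) * iexp (- 1 * t * y)) * (fourier f t * ?G t))"
    unfolding cnj_fourier by (simp add: mult_ac)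
  also have "\<dots> = (LINT y|lborel. cnj (g y) * (LINT t|lborel. fourier f t * ?G t * iexp (- 1 * t * y)))"
    by (rule integral_iexp_multiplication_formula[OF g' h])
  also have "(\<lambda>y. LINT t|lborel. fourier f t * ?G t * iexp (- 1 * t * y))
     = (\<lambda>y. of_real (sqrt (2 * pi)) * (LINT v|lborel. f (y + e * v) * of_real (exp (- v\<^sup>2 / 2))))"
    using integral_fourier_Gaussian[OF f e] by (simp add: mult.assoc)
  finally show ?thesis
    by (simp only: mult.left_commute[of "cnj (g y)" "of_real (sqrt (2 * pi))" for y] integral_mult_right_zero)
qed

text \<open>Dominated convergence twice with e = 1/(n+1): inside, continuity and boundedness of f
  let the Gaussian averages tend to sqrt(2 pi) f(x); outside, a constant multiple of |g| dominates.
  The second sqrt(2 pi) comes from the Gaussian's transform.\<close>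

lemma Gaussian_regularised_Parseval:
  fixes f g :: "real \<Rightarrow> complex"
  assumes f: "integrable lborel f" and g: "integrable lborel g"
    and cont: "continuous_on UNIV f" and bdd: "\<And>x. norm (f x) \<le> B"
  shows "(\<lambda>n. LINT t|lborel. fourier f t * cnj (fourier g t) * of_real (exp (- (t / Suc n)\<^sup>2 / 2)))
    \<longlonglongrightarrow> 2 * pi * (LINT x|lborel. f x * cnj (g x))"
proof -
  let ?\<phi> = "\<lambda>v::real. complex_of_real (exp (- v\<^sup>2 / 2))"
  have \<phi>: "has_bochner_integral lborel ?\<phi> (of_real (sqrt (2 * pi)))"
    using integral_Gaussian_iexp[of 1 0] by simp
  have [measurable]: "f \<in> borel_measurable borel" "g \<in> borel_measurable borel"
    using f g by auto
  have B: "0 \<le> B" using bdd[of 0] norm_ge_zero order_trans by blast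
  have \<phi>i: "integrable lborel ?\<phi>" using \<phi> by (simp add: has_bochner_integral_iff)
  define M where "M n x = (LINT v|lborel. f (x + v / Suc n) * ?\<phi> v)" for n :: nat and x
  have M_meas [measurable]: "M n \<in> borel_measurable lborel" for n
    unfolding M_def by measurable
  have M_lim: "(\<lambda>n. M n x) \<longlonglongrightarrow> f x * of_real (sqrt (2 * pi))" for x
  proof -
    have "(\<lambda>n. M n x) \<longlonglongrightarrow> (LINT v|lborel. f x * ?\<phi> v)"
      unfolding M_def
    proof (rule integral_dominated_convergence[where w = "\<lambda>v. B * norm (?\<phi> v)"])
      show "integrable lborel (\<lambda>v. B * norm (?\<phi> v))"
        using integrable_norm[OF \<phi>i] by (intro integrable_mult_right)
      show "AE v in lborel. (\<lambda>n. f (x + v / Suc n) * ?\<phi> v) \<longlonglongrightarrow> f x * ?\<phi> v"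
      proof (intro AE_I2 tendsto_mult tendsto_const)
        fix v
        have "(\<lambda>n. x + v * (1 / Suc n)) \<longlonglongrightarrow> x + v * 0"
          using LIMSEQ_inverse_real_of_nat by (intro tendsto_intros) (simp add: inverse_eq_divide)
        then show "(\<lambda>n. f (x + v / Suc n)) \<longlonglongrightarrow> f x"
          using cont by (intro isCont_tendsto_compose[of _ f]) (auto simp: continuous_on_eq_continuous_at)
      qed
      show "AE v in lborel. norm (f (x + v / Suc n) * ?\<phi> v) \<le> B * norm (?\<phi> v)" for n
        by (intro AE_I2) (simp add: norm_mult bdd mult_right_mono)
    qed measurable
    then show ?thesis
      using has_bochner_integral_integral_eq[OF \<phi>] by simp
  qed
  have M_bdd: "norm (M n x) \<le> B * sqrt (2 * pi)" for n x
  proof -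
    have "norm (M n x) \<le> (LINT v|lborel. norm (f (x + v / Suc n) * ?\<phi> v))"
      unfolding M_def by (rule integral_norm_bound)
    also have "\<dots> \<le> (LINT v|lborel. B * exp (- v\<^sup>2 / 2))"
    proof (rule integral_mono')
      show "integrable lborel (\<lambda>v. B * exp (- v\<^sup>2 / 2))"
        using integrable_norm[OF \<phi>i] by (intro integrable_mult_right) simp
    qed (auto simp: norm_mult bdd mult_right_mono B)
    also have "(LINT v|lborel. B * exp (- v\<^sup>2 / 2)) = B * sqrt (2 * pi)"
    proof -
      have "complex_of_real (LINT v|lborel. exp (- v\<^sup>2 / 2)) = of_real (sqrt (2 * pi))"
        using has_bochner_integral_integral_eq[OF \<phi>] by simp
      then show ?thesis by (simp only: of_real_eq_iff integral_mult_right_zero)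
    qed
    finally show ?thesis .
  qed
  have "(\<lambda>n. LINT x|lborel. cnj (g x) * M n x) \<longlonglongrightarrow> (LINT x|lborel. cnj (g x) * (f x * of_real (sqrt (2 * pi))))"
  proof (rule integral_dominated_convergence[where w = "\<lambda>x. norm (g x) * (B * sqrt (2 * pi))"])
    show "integrable lborel (\<lambda>x. norm (g x) * (B * sqrt (2 * pi)))"
      using g by (intro integrable_mult_left integrable_norm)
    show "AE x in lborel. norm (cnj (g x) * M n x) \<le> norm (g x) * (B * sqrt (2 * pi))" for n
      by (intro AE_I2) (simp add: norm_mult mult_left_mono M_bdd del: mult_le_cancel_left)
  qed (auto intro!: AE_I2 tendsto_mult M_lim)
  then have "(\<lambda>n. of_real (sqrt (2 * pi)) * (LINT x|lborel. cnj (g x) * M n x))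
     \<longlonglongrightarrow> of_real (sqrt (2 * pi)) * (LINT x|lborel. cnj (g x) * (f x * of_real (sqrt (2 * pi))))"
    by (intro tendsto_mult tendsto_const)
  moreover have "(LINT t|lborel. fourier f t * cnj (fourier g t) * of_real (exp (- (t / Suc n)\<^sup>2 / 2)))
     = of_real (sqrt (2 * pi)) * (LINT x|lborel. cnj (g x) * M n x)" for n
    using integral_fourier_cnj_fourier_Gaussian[OF f g, of "1 / Suc n"] by (simp add: M_def)
  moreover have "of_real (sqrt (2 * pi)) * (LINT x|lborel. cnj (g x) * (f x * of_real (sqrt (2 * pi))))
     = 2 * pi * (LINT x|lborel. f x * cnj (g x))"
  proof -
    have "(\<lambda>x. cnj (g x) * (f x * of_real (sqrt (2 * pi)))) = (\<lambda>x. of_real (sqrt (2 * pi)) * (f x * cnj (g x)))"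
      by (simp add: mult_ac)
    moreover have "complex_of_real (sqrt (2 * pi)) * complex_of_real (sqrt (2 * pi)) = 2 * pi"
      by (simp flip: of_real_mult)
    ultimately show ?thesis
      by (simp only: integral_mult_right_zero) (simp only: mult.assoc[symmetric])
  qed
  ultimately show ?thesis by simp
qed

text \<open>
  The Gaussian factors increase to 1, so convergence of the regularised integrals gives integrability
  by monotone convergence.
\<close>

lemma fourier_square_integrable:
  fixes f :: "real \<Rightarrow> complex"
  assumes f: "integrable lborel f" and cont: "continuous_on UNIV f" and bdd: "\<And>x. norm (f x) \<le> B"
  shows "integrable lborel (\<lambda>t. (norm (fourier f t))\<^sup>2)"
proof (rule integral_monotone_convergence_nonneg(1))
  let ?s = "\<lambda>n t. (norm (fourier f t))\<^sup>2 * exp (- (t / Suc n)\<^sup>2 / 2)"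
  have [measurable]: "f \<in> borel_measurable borel" using f by auto
  show "integrable lborel (?s n)" for n
  proof -
    have "integrable lborel (\<lambda>t. complex_of_real (exp (- (1 / Suc n * t)\<^sup>2 / 2)))"
      using integral_Gaussian_iexp[of "1 / Suc n" 0] by (simp add: has_bochner_integral_iff)
    then have "integrable lborel (\<lambda>t. (LINT y|lborel. norm (f y))\<^sup>2 * norm (complex_of_real (exp (- (1 / Suc n * t)\<^sup>2 / 2))))"
      by (intro integrable_mult_right integrable_norm)
    then show ?thesis
      by (rule Bochner_Integration.integrable_bound)
         (auto intro!: AE_I2 mult_right_mono power_mono norm_fourier_le)
  qed
  show "AE t in lborel. mono (\<lambda>n. ?s n t)"
  proof (intro AE_I2 monoI mult_left_mono)
    fix t and m n :: nat assume "m \<le> n"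
    then have "(\<bar>t\<bar> / Suc n)\<^sup>2 \<le> (\<bar>t\<bar> / Suc m)\<^sup>2"
      by (intro power_mono divide_left_mono) auto
    then show "exp (- (t / Suc m)\<^sup>2 / 2) \<le> exp (- (t / Suc n)\<^sup>2 / 2)"
      by (simp add: power_divide)
  qed auto
  show "AE t in lborel. (\<lambda>n. ?s n t) \<longlonglongrightarrow> (norm (fourier f t))\<^sup>2"
  proof (intro AE_I2)
    fix t
    have "(\<lambda>n. (norm (fourier f t))\<^sup>2 * exp (- (t * (1 / Suc n))\<^sup>2 / 2)) \<longlonglongrightarrow> (norm (fourier f t))\<^sup>2 * exp (- (t * 0)\<^sup>2 / 2)"
      using LIMSEQ_inverse_real_of_nat by (intro tendsto_intros) (auto simp: inverse_eq_divide)
    then show "(\<lambda>n. ?s n t) \<longlonglongrightarrow> (norm (fourier f t))\<^sup>2" by simp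
  qed
  have "(\<lambda>n. Re (LINT t|lborel. fourier f t * cnj (fourier f t) * of_real (exp (- (t / Suc n)\<^sup>2 / 2))))
    \<longlonglongrightarrow> Re (2 * pi * (LINT x|lborel. f x * cnj (f x)))"
    by (intro tendsto_Re Gaussian_regularised_Parseval[where B = B] assms)
  moreover have "Re (LINT t|lborel. fourier f t * cnj (fourier f t) * of_real (exp (- (t / Suc n)\<^sup>2 / 2)))
    = (LINT t|lborel. ?s n t)" for n
  proof -
    have "(\<lambda>t. fourier f t * cnj (fourier f t) * of_real (exp (- (t / Suc n)\<^sup>2 / 2))) = (\<lambda>t. complex_of_real (?s n t))"
      by (simp only: of_real_mult complex_norm_square)
    then show ?thesis by (simp only: integral_complex_of_real Re_complex_of_real)
  qed
  ultimately show "(\<lambda>n. LINT t|lborel. ?s n t) \<longlonglongrightarrow> Re (2 * pi * (LINT x|lborel. f x * cnj (f x)))"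
    by simp
qed (use f in auto)

text \<open>Since 2|uv| <= |u|^2 + |v|^2, the sum of the two squared transforms dominates the
  product. The regularised integrals therefore also converge to the unregularised one, and the two
  limits agree.\<close>

lemma Parseval_fourier:
  fixes f g :: "real \<Rightarrow> complex"
  assumes f: "integrable lborel f" "continuous_on UNIV f" "\<And>x. norm (f x) \<le> B"
    and g: "integrable lborel g" "continuous_on UNIV g" "\<And>x. norm (g x) \<le> C"
  shows "has_bochner_integral lborel (\<lambda>t. fourier f t * cnj (fourier g t))
    (2 * pi * (LINT x|lborel. f x * cnj (g x)))"
proof -
  have [measurable]: "f \<in> borel_measurable borel" "g \<in> borel_measurable borel" using f g by auto
  let ?w = "\<lambda>t. (norm (fourier f t))\<^sup>2 + (norm (fourier g t))\<^sup>2"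
  have w: "integrable lborel ?w"
    by (intro Bochner_Integration.integrable_add fourier_square_integrable[OF f] fourier_square_integrable[OF g])
  have bound: "norm (fourier f t * cnj (fourier g t)) \<le> ?w t" for t
  proof -
    have "2 * (norm (fourier f t) * norm (fourier g t)) \<le> ?w t"
      using sum_squares_bound[of "norm (fourier f t)" "norm (fourier g t)"] by (simp add: mult_ac)
    moreover have "0 \<le> norm (fourier f t) * norm (fourier g t)" by simp
    ultimately show ?thesis unfolding norm_mult complex_mod_cnj by linarith
  qed
  have int: "integrable lborel (\<lambda>t. fourier f t * cnj (fourier g t))"
    by (rule Bochner_Integration.integrable_bound[OF w]) (auto intro!: AE_I2 order_trans[OF bound])
  have "(\<lambda>n. LINT t|lborel. fourier f t * cnj (fourier g t) * of_real (exp (- (t / Suc n)\<^sup>2 / 2)))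
    \<longlonglongrightarrow> (LINT t|lborel. fourier f t * cnj (fourier g t))"
  proof (rule integral_dominated_convergence[OF _ _ w])
    show "AE t in lborel. (\<lambda>n. fourier f t * cnj (fourier g t) * of_real (exp (- (t / Suc n)\<^sup>2 / 2)))
        \<longlonglongrightarrow> fourier f t * cnj (fourier g t)"
    proof (intro AE_I2)
      fix t
      have "(\<lambda>n. fourier f t * cnj (fourier g t) * of_real (exp (- (t * (1 / Suc n))\<^sup>2 / 2)))
         \<longlonglongrightarrow> fourier f t * cnj (fourier g t) * of_real (exp (- (t * 0)\<^sup>2 / 2))"
        using LIMSEQ_inverse_real_of_nat by (intro tendsto_intros) (auto simp: inverse_eq_divide)
      then show "(\<lambda>n. fourier f t * cnj (fourier g t) * of_real (exp (- (t / Suc n)\<^sup>2 / 2)))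
        \<longlonglongrightarrow> fourier f t * cnj (fourier g t)" by simp
    qed
    show "AE t in lborel. norm (fourier f t * cnj (fourier g t) * of_real (exp (- (t / Suc n)\<^sup>2 / 2))) \<le> ?w t" for n
    proof (intro AE_I2)
      fix t
      have "norm (fourier f t * cnj (fourier g t)) * exp (- (t / Suc n)\<^sup>2 / 2) \<le> ?w t * 1"
        by (intro mult_mono bound) auto
      then show "norm (fourier f t * cnj (fourier g t) * of_real (exp (- (t / Suc n)\<^sup>2 / 2))) \<le> ?w t"
        unfolding norm_mult[of _ "of_real _"] by simp
    qed
  qed measurable
  with Gaussian_regularised_Parseval[OF f(1) g(1) f(2,3)] int show ?thesis
    by (simp add: has_bochner_integral_iff LIMSEQ_unique)
qed

subsection \<open>Moments of the measures\<close>

lemma has_bochner_integral_Gamma_lborel: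
  assumes "x > (0::real)"
  shows "has_bochner_integral lborel (\<lambda>t. indicator {0<..} t * (t powr (x - 1) / exp t)) (Gamma x)"
proof (rule has_bochner_integral_nn_integral)
  have "(\<integral>\<^sup>+t. ennreal (indicator {0<..} t * (t powr (x - 1) / exp t)) \<partial>lborel)
      = (\<integral>\<^sup>+t. ennreal (indicator {0..} t * (t powr (x - 1) / exp t)) \<partial>lborel)"
    by (intro nn_integral_cong) (auto simp: indicator_def)
  then show "(\<integral>\<^sup>+t. ennreal (indicator {0<..} t * (t powr (x - 1) / exp t)) \<partial>lborel) = ennreal (Gamma x)"
    using Gamma_conv_nn_integral_real[OF assms] by (simp add: mult.assoc)
qed (use assms in \<open>auto intro!: Gamma_real_nonneg\<close>)

text \<open>For alpha = beta the factorial step is 0, so plain moments are the factorial moments.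
  Substituting x = a t reduces them to a^n Gamma(s+n) / Gamma(s).\<close>

lemma meixner_gamma_moments:
  assumes a: "a > 0" and \<sigma>: "\<sigma> > 0"
  shows "has_bochner_integral (meixner_gamma_measure a \<sigma>) (\<lambda>x. x ^ n) (a ^ n * pochhammer (\<sigma> / (a * a)) n)"
proof -
  define s where "s = \<sigma> / (a * a)"
  have s: "s > 0" using a \<sigma> by (simp add: s_def)
  define g where "g x = indicator {0<..} x * (1 / Gamma s * a powr - s * x powr (-1 + s) * exp (- x / a))" for x :: real
  have [measurable]: "g \<in> borel_measurable borel" unfolding g_def by measurable
  have g_nonneg: "0 \<le> g x" for x
    unfolding g_def using s by (auto intro!: mult_nonneg_nonneg Gamma_real_nonneg)
  have M: "meixner_gamma_measure a \<sigma> = density lborel g"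
    unfolding meixner_gamma_measure_def Let_def g_def s_def by simp
  \<comment> \<open>In the density at a t, the factor a^(-s) meets a^(s-1), leaving the 1/a of this
    constant; it is the Jacobian factor of the substitution.\<close>
  have "has_bochner_integral lborel (\<lambda>t. a ^ n / (a * Gamma s) * (indicator {0<..} t * (t powr (s + n - 1) / exp t)))
     (a ^ n / (a * Gamma s) * Gamma (s + n))"
    using s by (intro has_bochner_integral_mult_right has_bochner_integral_Gamma_lborel) simp
  moreover have "a ^ n / (a * Gamma s) * (indicator {0<..} t * (t powr (s + n - 1) / exp t))
     = g (0 + a * t) *\<^sub>R (0 + a * t) ^ n" for t
  proof (cases "t > 0")
    case True
    have "(a * t) powr (-1 + s) = a powr s / a * t powr (-1 + s)"
      using a True by (simp add: powr_mult powr_diff)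
    moreover have "t powr (s + n - 1) = t powr (-1 + s) * t ^ n"
    proof -
      have "s + n - 1 = (-1 + s) + real n" by simp
      then show ?thesis by (simp only: powr_add powr_realpow[OF True])
    qed
    ultimately show ?thesis
      using True a Gamma_real_pos[OF s] by (simp add: g_def power_mult_distrib powr_minus exp_minus field_simps)
  next
    case False
    then show ?thesis using a by (simp add: g_def zero_less_mult_iff)
  qed
  moreover have "a ^ n / (a * Gamma s) * Gamma (s + n) = (a ^ n * pochhammer s n) /\<^sub>R \<bar>a\<bar>"
  proof -
    have "s \<notin> \<int>\<^sub>\<le>\<^sub>0" using s by (auto elim!: nonpos_Ints_cases)
    then show ?thesis using a s by (simp add: Gamma_plus_of_nat divide_inverse Gamma_eq_zero_iff)
  qed
  ultimately have "has_bochner_integral lborel (\<lambda>t. g (0 + a * t) *\<^sub>R (0 + a * t) ^ n) ((a ^ n * pochhammer s n) /\<^sub>R \<bar>a\<bar>)"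
    by simp
  then have "has_bochner_integral lborel (\<lambda>x. g x *\<^sub>R x ^ n) (a ^ n * pochhammer s n)"
    using lborel_has_bochner_integral_real_affine_iff[of a "\<lambda>x. g x *\<^sub>R x ^ n" _ 0] a by blast
  then show ?thesis
    unfolding M s_def[symmetric]
    by (intro has_bochner_integral_density) (auto simp: g_nonneg)
qed

text \<open>At the atom (a-b) n the product is (a-b)^k n(n-1)...(n-k+1), which vanishes for n < k.
  Shifting n by k leaves the binomial series of (1-q)^(-(s+k)) with q = b/a, and (a-b) q = b (1-q)
  absorbs the surplus (1-q)^(-k).\<close>

lemma meixner_negbinomial_factorial_moments:
  assumes b: "b > 0" and ab: "a > b" and \<sigma>: "\<sigma> > 0"
  shows "has_bochner_integral (meixner_negbinomial_measure a b \<sigma>)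
    (\<lambda>x. \<Prod>i<k. x - real i * (a - b)) (b ^ k * pochhammer (\<sigma> / (a * b)) k)"
proof -
  define s where "s = \<sigma> / (a * b)"
  define q where "q = b / a"
  define w where "w n = (1 - q) powr s * (q ^ n * (1 / fact n) * pochhammer s n)" for n
  define f where "f x = (\<Prod>i<k. x - real i * (a - b))" for x
  have a: "a > 0" using b ab by simp
  have s: "s > 0" using a b \<sigma> by (simp add: s_def)
  have q: "0 < q" "q < 1" using a b ab by (auto simp: q_def)
  have w_nonneg: "0 \<le> w n" for n
    unfolding w_def using pochhammer_pos[OF s, of n] q by (intro mult_nonneg_nonneg) auto
  have f_meas: "f \<in> borel_measurable borel" unfolding f_def by measurable
  have f_eq: "f ((a - b) * real n) = (a - b) ^ k * (\<Prod>i<k. real n - real i)" for n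
  proof -
    have "f ((a - b) * real n) = (\<Prod>i<k. (a - b) * (real n - real i))"
      unfolding f_def by (intro prod.cong) (auto simp: algebra_simps)
    then show ?thesis by (simp add: prod.distrib)
  qed
  have f_small: "f ((a - b) * real n) = 0" if "n < k" for n
    unfolding f_eq using that by auto
  have f_large: "f ((a - b) * real (m + k)) = (a - b) ^ k * (fact (m + k) / fact m)" for m
  proof -
    have "(\<Prod>i<k. real (m + k) - real i) = fact (m + k) / fact m"
    proof (induction k)
      case (Suc k)
      have "(\<Prod>i<Suc k. real (m + Suc k) - real i) = real (m + Suc k) * (\<Prod>i<k. real (m + k) - real i)"
        unfolding prod.lessThan_Suc_shift by simp
      then show ?case using Suc by simp
    qed simp
    then show ?thesis unfolding f_eq by simp
  qed
  have shift: "w (m + k) * f ((a - b) * real (m + k))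
      = (1 - q) powr s * (a - b) ^ k * q ^ k * pochhammer s k * ((- (s + k) gchoose m) * (- q) ^ m)" for m
  proof -
    have "pochhammer s (m + k) = pochhammer s k * pochhammer (s + k) m"
      using pochhammer_product'[of s k m] by (simp add: add.commute)
    moreover have "(- (s + k) gchoose m) = (-1) ^ m * (pochhammer (s + k) m / fact m)"
      unfolding gbinomial_pochhammer by (simp only: minus_minus times_divide_eq_right)
    ultimately show ?thesis
      unfolding f_large w_def by (simp add: power_minus[of q] power_add)
  qed
  have "(\<lambda>m. (1 - q) powr s * (a - b) ^ k * q ^ k * pochhammer s k * ((- (s + k) gchoose m) * (- q) ^ m))
      sums ((1 - q) powr s * (a - b) ^ k * q ^ k * pochhammer s k * (1 + - q) powr (- (s + k)))"
    using q by (intro sums_mult gen_binomial_real) auto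
  moreover have "(1 - q) powr s * (a - b) ^ k * q ^ k * pochhammer s k * (1 + - q) powr (- (s + k)) = b ^ k * pochhammer s k"
  proof -
    have "(1 - q) powr s * (1 - q) powr (- (s + k)) = 1 / (1 - q) ^ k"
      using q by (simp add: powr_minus_divide powr_realpow flip: powr_add)
    moreover have "(a - b) * q = b * (1 - q)" using a by (simp add: q_def field_simps)
    then have "(a - b) ^ k * q ^ k = b ^ k * (1 - q) ^ k" by (metis power_mult_distrib)
    ultimately show ?thesis using q
      by (simp add: mult_ac)
  qed
  ultimately have "(\<lambda>m. w (m + k) * f ((a - b) * real (m + k))) sums (b ^ k * pochhammer s k)"
    unfolding shift by (simp only:)
  then have sums: "(\<lambda>n. w n * f ((a - b) * real n)) sums (b ^ k * pochhammer s k)"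
    by (subst (asm) sums_iff_shift) (simp add: f_small)
  \<comment> \<open>Nonnegative terms turn the convergence of the series into absolute convergence,
    which integrability over the counting measure requires.\<close>
  have nonneg: "0 \<le> w n * f ((a - b) * real n)" for n
  proof (cases "n < k")
    case False
    then obtain m where "n = m + k" by (metis add.commute le_Suc_ex not_less)
    then have "0 \<le> f ((a - b) * real n)" using ab by (simp only: f_large) simp
    then show ?thesis using w_nonneg by simp
  qed (simp add: f_small)
  have int: "integrable (count_space UNIV) (\<lambda>n. w n * f ((a - b) * real n))"
    using sums nonneg by (simp add: integrable_count_space_nat_iff sums_iff)
  then have "has_bochner_integral (count_space UNIV) (\<lambda>n. w n *\<^sub>R f ((a - b) * real n)) (b ^ k * pochhammer s k)"
    using integral_count_space_nat[OF int] sums by (simp add: has_bochner_integral_iff sums_iff)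
  then have "has_bochner_integral (density (count_space UNIV) w) (\<lambda>n. f ((a - b) * real n)) (b ^ k * pochhammer s k)"
    by (intro has_bochner_integral_density) (auto simp: w_nonneg)
  then have "has_bochner_integral (distr (density (count_space UNIV) w) borel (\<lambda>n. (a - b) * real n)) f (b ^ k * pochhammer s k)"
    by (intro has_bochner_integral_distr) (auto simp: f_meas)
  then show ?thesis
    unfolding meixner_negbinomial_measure_def Let_def f_def w_def q_def s_def by simp
qed

text \<open>
  $t \mapsto \Gamma(p+it)\, w^{-(p+it)}$ with $w = e^{i\theta}$ is the Fourier transform of
  $y \mapsto \exp(py - we^y)$. The factor $w^{-it} = e^{\theta t}$ produces the exponential weight,
  and Parseval's identity reduces the integral of the product to a single Gamma integral.
\<close>

lemma Gamma_product_integral: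
  fixes p q \<theta> :: real
  assumes p: "p > 0" and q: "q > 0" and \<theta>: "\<bar>\<theta>\<bar> < pi / 2"
  shows "has_bochner_integral lborel
    (\<lambda>t. Gamma (of_real p + \<i> * of_real t) * cnj (Gamma (of_real q + \<i> * of_real t)) * of_real (exp (2 * \<theta> * t)))
    (2 * pi * Gamma (p + q) * (2 * cos \<theta>) powr - (p + q) * exp (\<i> * of_real (\<theta> * (p - q))))"
proof -
  define w where "w = exp (\<i> * of_real \<theta>)"
  define G where "G p y = exp (of_real p * of_real y - w * of_real (exp y))" for p y :: real
  have c: "cos \<theta> > 0" using \<theta> by (intro cos_gt_zero_pi) auto
  have Re_w: "Re w = cos \<theta>" by (simp add: w_def Re_exp)
  have Ln_w: "Ln w = \<i> * of_real \<theta>" unfolding w_def using \<theta> pi_gt_zero by (intro Ln_exp) (auto simp: abs_less_iff)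
  have w0: "w \<noteq> 0" by (simp add: w_def)
  have G_int: "integrable lborel (G p)" if "p > 0" for p
    unfolding G_def using has_bochner_integral_Gamma_exp_right_halfplane[of "of_real p" w] that c Re_w
    by (simp add: has_bochner_integral_iff)
  have G_cont: "continuous_on UNIV (G p)" for p
    unfolding G_def by (intro continuous_intros)
  have G_bdd: "norm (G p y) \<le> exp (p * ln (p / cos \<theta>) - p)" if "p > 0" for p y
  proof -
    \<comment> \<open>The function p y - cos(theta) e^y is maximal at y = ln(p / cos(theta));
      expanding e^x >= 1 + x around that point gives the sharp bound.\<close>
    have "p * (1 + (y - ln (p / cos \<theta>))) \<le> p * exp (y - ln (p / cos \<theta>))"
      using that by (intro mult_left_mono exp_ge_add_one_self) auto
    also have "\<dots> = cos \<theta> * exp y"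
      using that c by (simp add: exp_diff)
    finally have "p * y - cos \<theta> * exp y \<le> p * ln (p / cos \<theta>) - p"
      by (simp add: algebra_simps)
    then show ?thesis by (simp add: G_def Re_w)
  qed
  have fourier_G: "fourier (G p) t = Gamma (of_real p + \<i> * of_real t) * exp (- \<i> * of_real (\<theta> * p) + of_real (\<theta> * t))"
    if "p > 0" for p t
  proof -
    have "fourier (G p) t = (LINT y|lborel. exp ((of_real p + \<i> * of_real t) * of_real y - w * of_real (exp y)))"
      unfolding fourier_def G_def by (simp add: algebra_simps flip: exp_add)
    also have "\<dots> = Gamma (of_real p + \<i> * of_real t) * w powr - (of_real p + \<i> * of_real t)"
      using that c Re_w by (intro has_bochner_integral_integral_eq has_bochner_integral_Gamma_exp_right_halfplane) auto
    also have "w powr - (of_real p + \<i> * of_real t) = exp (- \<i> * of_real (\<theta> * p) + of_real (\<theta> * t))"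
      using w0 by (simp add: powr_def Ln_w algebra_simps)
    finally show ?thesis .
  qed
  have "(LINT y|lborel. G p y * cnj (G q y)) = (LINT y|lborel. exp (of_real (p + q) * of_real y - of_real (2 * cos \<theta>) * of_real (exp y)))"
  proof (rule Bochner_Integration.integral_cong)
    fix y
    \<comment> \<open>Multiplying by the conjugate adds the coefficients of e^y; their sum 2
      cos(theta) is real and positive, so a Gamma integral at p + q remains.\<close>
    have "w + cnj w = of_real (2 * cos \<theta>)" by (simp add: complex_add_cnj Re_w)
    then have "w * of_real (exp y) + cnj w * of_real (exp y) = of_real (2 * cos \<theta>) * of_real (exp y)"
      by (simp only: distrib_right[symmetric])
    then have "of_real p * of_real y - w * of_real (exp y) + (of_real q * of_real y - cnj w * of_real (exp y))
      = of_real (p + q) * of_real y - of_real (2 * cos \<theta>) * of_real (exp y)"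
      by (simp add: algebra_simps)
    then show "G p y * cnj (G q y) = exp (of_real (p + q) * of_real y - of_real (2 * cos \<theta>) * of_real (exp y))"
      unfolding G_def exp_cnj by (simp flip: exp_add)
  qed simp
  also have "\<dots> = Gamma (of_real (p + q)) * of_real (2 * cos \<theta>) powr - of_real (p + q)"
    using p q c by (intro has_bochner_integral_integral_eq has_bochner_integral_Gamma_exp_right_halfplane) auto
  also have "\<dots> = of_real (Gamma (p + q) * (2 * cos \<theta>) powr - (p + q))"
    using c by (simp only: Gamma_complex_of_real of_real_mult powr_of_real[symmetric] flip: of_real_minus)
  finally have GG: "(LINT y|lborel. G p y * cnj (G q y)) = of_real (Gamma (p + q) * (2 * cos \<theta>) powr - (p + q))" .
  have "has_bochner_integral lborel (\<lambda>t. fourier (G p) t * cnj (fourier (G q) t))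
    (2 * pi * (LINT y|lborel. G p y * cnj (G q y)))"
    by (rule Parseval_fourier[OF G_int[OF p] G_cont G_bdd[OF p] G_int[OF q] G_cont G_bdd[OF q]])
  \<comment> \<open>The prefactor cancels the constant phases exp(-i theta p) and exp(i theta q) of
    the two transforms.\<close>
  then have "has_bochner_integral lborel (\<lambda>t. exp (\<i> * of_real (\<theta> * (p - q))) * (fourier (G p) t * cnj (fourier (G q) t)))
    (exp (\<i> * of_real (\<theta> * (p - q))) * (2 * pi * (LINT y|lborel. G p y * cnj (G q y))))"
    by (intro has_bochner_integral_mult_right)
  moreover have "exp (\<i> * of_real (\<theta> * (p - q))) * (fourier (G p) t * cnj (fourier (G q) t))
    = Gamma (of_real p + \<i> * of_real t) * cnj (Gamma (of_real q + \<i> * of_real t)) * of_real (exp (2 * \<theta> * t))" for t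
  proof -
    have "exp (\<i> * of_real (\<theta> * (p - q))) * (exp (- \<i> * of_real (\<theta> * p) + of_real (\<theta> * t)) * cnj (exp (- \<i> * of_real (\<theta> * q) + of_real (\<theta> * t))))
      = exp (of_real (2 * \<theta> * t))"
      unfolding exp_cnj exp_add[symmetric] by (simp add: algebra_simps)
    then show ?thesis
      unfolding fourier_G[OF p] fourier_G[OF q] exp_of_real complex_cnj_mult by (simp only: mult_ac)
  qed
  ultimately show ?thesis unfolding GG by (simp add: mult_ac)
qed

lemma of_real_divide_complex: "of_real x / z = of_real (x / (cmod z)\<^sup>2) * cnj z"
  by (subst complex_div_cnj) simp

lemma gen_ffact_mult: "gen_ffact (c * u) (- c) k = c ^ k * pochhammer u k"
  using gen_ffact_uminus_eq_pochhammer[of u c k] by (simp add: mult.commute)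

text \<open>
  After the substitution $x = 2bt - sa$ (with $\alpha = a + ib$, $s = \sigma/\eta$) the argument of
  the Gamma function becomes $u = s/2 + it$, while $x + \sigma/\alpha = -2ibu$ and
  $\alpha - \overline\alpha = 2ib$.
\<close>

lemma meixner_pollaczek_factorial_moments:
  fixes \<alpha> :: complex
  assumes \<sigma>: "\<sigma> > 0" and Re: "Re \<alpha> \<ge> 0" and Im: "Im \<alpha> > 0"
  shows "has_bochner_integral (meixner_pollaczek_measure \<alpha> \<sigma>)
    (\<lambda>x. gen_ffact (of_real x + of_real \<sigma> / \<alpha>) (\<alpha> - cnj \<alpha>) k)
    (cnj \<alpha> ^ k * pochhammer (of_real (\<sigma> / (cmod \<alpha>)\<^sup>2)) k)"
proof -
  define a b s \<theta> where "a = Re \<alpha>" and "b = Im \<alpha>" and "s = \<sigma> / (cmod \<alpha>)\<^sup>2" and "\<theta> = pi / 2 - Arg \<alpha>"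
  have \<alpha>0: "\<alpha> \<noteq> 0" using Im by auto
  have b: "b > 0" using Im by (simp add: b_def)
  have s: "s > 0" using \<sigma> \<alpha>0 by (simp add: s_def)
  have Arg: "0 < Arg \<alpha>" "Arg \<alpha> \<le> pi / 2"
    using Im Re Arg_lt_pi[of \<alpha>] Arg_Re_nonneg[of \<alpha>] by auto
  then have \<theta>: "\<bar>\<theta>\<bar> < pi / 2" by (simp add: \<theta>_def abs_less_iff)
  have c: "cos \<theta> > 0" using \<theta> by (intro cos_gt_zero_pi) auto
  have polar: "\<alpha> = of_real (cmod \<alpha>) * exp (\<i> * of_real (Arg \<alpha>))"
    using Arg_eq[OF \<alpha>0] .
  have b_eq: "b = cmod \<alpha> * cos \<theta>"
    unfolding b_def by (subst polar) (simp add: \<theta>_def Im_exp cos_diff)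
  have \<beta>_eq: "cnj \<alpha> = - \<i> * of_real (cmod \<alpha>) * exp (\<i> * of_real \<theta>)"
  proof -
    have "exp (\<i> * of_real \<theta>) = exp (\<i> * of_real (pi / 2)) * exp (- (\<i> * of_real (Arg \<alpha>)))"
      by (simp add: \<theta>_def algebra_simps flip: exp_add)
    also have "exp (\<i> * of_real (pi / 2)) = \<i>"
      by (simp add: exp_eq_polar complex_eq_iff)
    finally have "exp (\<i> * of_real \<theta>) = \<i> * exp (- (\<i> * of_real (Arg \<alpha>)))" .
    moreover have "cnj \<alpha> = of_real (cmod \<alpha>) * exp (- (\<i> * of_real (Arg \<alpha>)))"
      by (subst polar) (simp add: exp_cnj)
    ultimately show ?thesis by (simp add: mult_ac)
  qed
  have \<alpha>_eq: "\<alpha> = of_real a + \<i> * of_real b" "cnj \<alpha> = of_real a - \<i> * of_real b"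
    by (simp_all add: a_def b_def complex_eq_iff)
  have diff: "\<alpha> - cnj \<alpha> = - (- 2 * \<i> * of_real b)" unfolding \<alpha>_eq by simp
  have \<sigma>\<alpha>: "of_real \<sigma> / \<alpha> = of_real s * cnj \<alpha>"
    unfolding s_def by (rule of_real_divide_complex)
  define u where "u t = of_real (s / 2) + \<i> * of_real t" for t :: real
  have u_nonpos: "u t \<notin> \<int>\<^sub>\<le>\<^sub>0" for t
    using s by (auto elim!: nonpos_Ints_cases simp: u_def complex_eq_iff)
  define C where "C = meixner_pollaczek_const \<alpha> \<sigma>"
  have C: "C = (2 * cos \<theta>) powr s / (4 * b * pi * Gamma s) * exp (\<theta> * s * a / b)"
    unfolding C_def meixner_pollaczek_const_def Let_def s_def a_def b_def \<theta>_def by (simp add: mult_ac)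
  have C_nonneg: "C \<ge> 0" unfolding C using b s by (auto intro!: mult_nonneg_nonneg Gamma_real_nonneg)
  define g where "g x = C * exp (\<theta> * x / b) * (cmod (Gamma (\<i> * of_real x / of_real (2 * b)
                    + \<i> * of_real \<sigma> * cnj \<alpha> / of_real (2 * (cmod \<alpha>)\<^sup>2 * b))))\<^sup>2" for x
  have g_nonneg: "0 \<le> g x" for x unfolding g_def using C_nonneg by simp
  have M: "meixner_pollaczek_measure \<alpha> \<sigma> = density lborel g"
    unfolding meixner_pollaczek_measure_def Let_def g_def C_def \<theta>_def b_def by simp
  define h where "h x = gen_ffact (of_real x + of_real \<sigma> / \<alpha>) (\<alpha> - cnj \<alpha>) k" for x
  have arg: "\<i> * of_real (- s * a + 2 * b * t) / of_real (2 * b) + \<i> * of_real \<sigma> * cnj \<alpha> / of_real (2 * (cmod \<alpha>)\<^sup>2 * b) = u t" for t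
  proof -
    have "\<i> * of_real \<sigma> * cnj \<alpha> / of_real (2 * (cmod \<alpha>)\<^sup>2 * b) = \<i> * of_real s * cnj \<alpha> / of_real (2 * b)"
      by (simp add: s_def)
    then show ?thesis unfolding \<alpha>_eq u_def using b by (simp add: field_simps)
  qed
  \<comment> \<open>Measurability is checked after the substitution, where the Gamma argument runs
    along Re u = s/2 > 0 and avoids the poles, and is carried back by the inverse affine
    map.\<close>
  have g_meas: "g \<in> borel_measurable borel"
  proof -
    have "continuous_on UNIV (\<lambda>t. C * exp (\<theta> * (- s * a + 2 * b * t) / b) * (cmod (Gamma (u t)))\<^sup>2)"
      unfolding continuous_on_eq_continuous_at[OF open_UNIV] u_def using b u_nonpos[unfolded u_def]
      by (intro ballI continuous_intros) auto
    then have "(\<lambda>t. g (- s * a + 2 * b * t)) \<in> borel_measurable borel"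
      unfolding g_def arg by (rule borel_measurable_continuous_onI)
    from measurable_compose[OF _ this, of "\<lambda>x. (x + s * a) / (2 * b)" borel] show ?thesis using b by simp
  qed
  have h_meas: "h \<in> borel_measurable borel"
    unfolding h_def gen_ffact_def by (intro borel_measurable_continuous_onI continuous_intros)
  have h_eq: "h (- s * a + 2 * b * t) = (- 2 * \<i> * of_real b) ^ k * pochhammer (u t) k" for t
  proof -
    have "of_real (- s * a + 2 * b * t) + of_real \<sigma> / \<alpha> = (- 2 * \<i> * of_real b) * u t"
      unfolding \<sigma>\<alpha> unfolding \<alpha>_eq(2) u_def by (simp add: algebra_simps)
    then show ?thesis unfolding h_def diff gen_ffact_mult[symmetric] by (simp only:)
  qed
  \<comment> \<open>At x = -sa + 2bt the weight exp(theta x / b) splits into exp(-theta s a / b) and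
    exp(2 theta t). \<open>?K\<close> collects the part independent of t, together with (-2ib)^k
    from the factorial.\<close>
  let ?K = "of_real (C * exp (- (\<theta> * s * a / b))) * (- 2 * \<i> * of_real b) ^ k"
  have "has_bochner_integral lborel
     (\<lambda>t. ?K * (Gamma (of_real (s / 2 + k) + \<i> * of_real t) * cnj (Gamma (of_real (s / 2) + \<i> * of_real t)) * of_real (exp (2 * \<theta> * t))))
     (?K * (2 * pi * Gamma (s / 2 + k + s / 2) * (2 * cos \<theta>) powr - (s / 2 + k + s / 2) * exp (\<i> * of_real (\<theta> * (s / 2 + k - s / 2)))))"
    using s \<theta> by (intro has_bochner_integral_mult_right Gamma_product_integral) auto
  moreover have "?K * (Gamma (of_real (s / 2 + k) + \<i> * of_real t) * cnj (Gamma (of_real (s / 2) + \<i> * of_real t)) * of_real (exp (2 * \<theta> * t)))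
     = g (- s * a + 2 * b * t) *\<^sub>R h (- s * a + 2 * b * t)" for t
  proof -
    have "Gamma (of_real (s / 2 + k) + \<i> * of_real t) = Gamma (u t) * pochhammer (u t) k"
      using Gamma_plus_of_nat[OF u_nonpos, of t k] by (simp add: u_def add_ac)
    moreover have "exp (\<theta> * (- s * a + 2 * b * t) / b) = exp (- (\<theta> * s * a / b)) * exp (2 * \<theta> * t)"
      using b by (simp add: field_simps flip: exp_add)
    moreover have "of_real ((cmod (Gamma (u t)))\<^sup>2) = Gamma (u t) * cnj (Gamma (u t))"
      by (simp only: complex_norm_square)
    moreover have "Gamma (of_real (s / 2) + \<i> * of_real t) = Gamma (u t)" by (simp add: u_def)
    ultimately show ?thesis
      unfolding g_def arg h_eq scaleR_conv_of_real
      by (simp only: of_real_mult) (simp only: mult_ac)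
  qed
  moreover have "?K * (2 * pi * Gamma (s / 2 + k + s / 2) * (2 * cos \<theta>) powr - (s / 2 + k + s / 2) * exp (\<i> * of_real (\<theta> * (s / 2 + k - s / 2))))
    = (cnj \<alpha> ^ k * pochhammer (of_real s) k) /\<^sub>R \<bar>2 * b\<bar>"
  proof -
    have "s \<notin> \<int>\<^sub>\<le>\<^sub>0" using s by (auto elim!: nonpos_Ints_cases)
    then have 1: "Gamma (s / 2 + k + s / 2) = Gamma s * pochhammer s k"
      using Gamma_plus_of_nat[of s k] by (simp add: add_ac)
    have 2: "(2 * cos \<theta>) powr - (s / 2 + k + s / 2) = 1 / ((2 * cos \<theta>) powr s * (2 * cos \<theta>) ^ k)"
    proof -
      have "- (s / 2 + k + s / 2) = - (s + k)" and "2 * cos \<theta> > 0" using c by simp_all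
      then show ?thesis by (simp only: powr_minus_divide powr_add powr_realpow)
    qed
    have "exp (\<i> * of_real (\<theta> * (s / 2 + k - s / 2))) = exp (of_nat k * (\<i> * of_real \<theta>))"
      by (simp add: mult_ac)
    then have 3: "exp (\<i> * of_real (\<theta> * (s / 2 + k - s / 2))) = exp (\<i> * of_real \<theta>) ^ k"
      by (simp only: exp_of_nat_mult)
    \<comment> \<open>Here the power of beta arises: b = |alpha| cos(theta) and the polar form of
      \<open>cnj \<alpha>\<close> turn the step -2ib and the phase exp(i theta) left by the Gamma
      product into a positive multiple of \<open>cnj \<alpha>\<close>.\<close>
    have 4: "- 2 * \<i> * of_real b * exp (\<i> * of_real \<theta>) = of_real (2 * cos \<theta>) * cnj \<alpha>"
      unfolding \<beta>_eq b_eq by simp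
    have 5: "(- 2 * \<i> * of_real b) ^ k * exp (\<i> * of_real \<theta>) ^ k = of_real ((2 * cos \<theta>) ^ k) * cnj \<alpha> ^ k"
      unfolding power_mult_distrib[symmetric] 4 by (simp add: power_mult_distrib)
    \<comment> \<open>The normalising constant cancels Gamma(s), (2 cos(theta))^s and the
      exponential; 2 pi over 4 b pi leaves 1/(2b), the Jacobian of the substitution.\<close>
    have 6: "C * exp (- (\<theta> * s * a / b)) * (2 * pi * (Gamma s * pochhammer s k) * (1 / ((2 * cos \<theta>) powr s * (2 * cos \<theta>) ^ k))) * (2 * cos \<theta>) ^ k
      = pochhammer s k / (2 * b)"
    proof -
      have "exp (\<theta> * s * a / b) * exp (- (\<theta> * s * a / b)) = 1" by (simp flip: exp_add)
      moreover have "Gamma s > 0" using s by (rule Gamma_real_pos)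
      moreover have "(2 * cos \<theta>) powr s > 0" "(2 * cos \<theta>) ^ k > 0" using c by auto
      ultimately show ?thesis unfolding C using b by (simp add: field_simps)
    qed
    have "?K * (2 * pi * Gamma (s / 2 + k + s / 2) * (2 * cos \<theta>) powr - (s / 2 + k + s / 2) * exp (\<i> * of_real (\<theta> * (s / 2 + k - s / 2))))
      = of_real (C * exp (- (\<theta> * s * a / b)) * (2 * pi * (Gamma s * pochhammer s k) * (1 / ((2 * cos \<theta>) powr s * (2 * cos \<theta>) ^ k))))
        * ((- 2 * \<i> * of_real b) ^ k * exp (\<i> * of_real \<theta>) ^ k)"
      unfolding 1 2 3 by simp
    also have "\<dots> = of_real (pochhammer s k / (2 * b)) * cnj \<alpha> ^ k"
      unfolding 5 6[symmetric] by (simp only: of_real_mult mult_ac)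
    finally show ?thesis
      using b by (simp add: scaleR_conv_of_real pochhammer_of_real field_simps)
  qed
  ultimately have "has_bochner_integral lborel (\<lambda>t. g (- s * a + 2 * b * t) *\<^sub>R h (- s * a + 2 * b * t))
     ((cnj \<alpha> ^ k * pochhammer (of_real s) k) /\<^sub>R \<bar>2 * b\<bar>)"
    by (simp only:)
  then have "has_bochner_integral lborel (\<lambda>x. g x *\<^sub>R h x) (cnj \<alpha> ^ k * pochhammer (of_real s) k)"
    using lborel_has_bochner_integral_real_affine_iff[of "2 * b" "\<lambda>x. g x *\<^sub>R h x" _ "- s * a"] b by simp
  then show ?thesis
    unfolding M s_def[symmetric] h_def[symmetric]
    by (intro has_bochner_integral_density) (auto simp: g_nonneg g_meas h_meas)
qed

section \<open>Factorial moments of the combined family and the final moment formulas\<close>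

lemma meixner_measure_eq_gamma:
  "a > 0 \<Longrightarrow> meixner_measure (of_real a) (of_real a) \<sigma> = meixner_gamma_measure a \<sigma>"
  by (simp add: meixner_measure_def)

lemma meixner_measure_eq_negbinomial:
  "0 < b \<Longrightarrow> b < a \<Longrightarrow> meixner_measure (of_real a) (of_real b) \<sigma> = meixner_negbinomial_measure a b \<sigma>"
  by (simp add: meixner_measure_def)

lemma meixner_measure_eq_pollaczek:
  "0 \<le> Re \<alpha> \<Longrightarrow> 0 < Im \<alpha> \<Longrightarrow> meixner_measure \<alpha> (cnj \<alpha>) \<sigma> = meixner_pollaczek_measure \<alpha> \<sigma>"
  by (auto simp: meixner_measure_def complex_is_Real_iff)

lemma meixner_measure_factorial_moments_real:
  fixes a b \<sigma> :: real
  assumes b: "b > 0" and ab: "a \<ge> b" and \<sigma>: "\<sigma> > 0"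
  shows "has_bochner_integral (meixner_measure (of_real a) (of_real b) \<sigma>)
    (\<lambda>x. gen_ffact (of_real x) (of_real a - of_real b) k) (gen_ffact (of_real \<sigma> / of_real a) (- of_real b) k)"
proof -
  have c: "of_real \<sigma> / of_real a = complex_of_real (\<sigma> / (a * b)) * of_real b"
    using b by simp
  have f: "gen_ffact (of_real x) (of_real a - of_real b) k = of_real (\<Prod>i<k. x - real i * (a - b))" for x
    by (simp add: gen_ffact_def)
  have m: "gen_ffact (of_real \<sigma> / of_real a) (- of_real b) k = of_real (b ^ k * pochhammer (\<sigma> / (a * b)) k)"
    unfolding c gen_ffact_uminus_eq_pochhammer by (simp only: pochhammer_of_real of_real_mult of_real_power)
  have "has_bochner_integral (meixner_measure (of_real a) (of_real b) \<sigma>)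
    (\<lambda>x. \<Prod>i<k. x - real i * (a - b)) (b ^ k * pochhammer (\<sigma> / (a * b)) k)"
  \<comment> \<open>At a = b every factor of the product is x, so the k-th power moment of the gamma
    measure is the required factorial moment.\<close>
  proof (cases "a = b")
    case True
    then show ?thesis
      using meixner_gamma_moments[OF b \<sigma>, of k] b by (simp add: meixner_measure_eq_gamma)
  next
    case False
    then show ?thesis
      using meixner_negbinomial_factorial_moments[OF b _ \<sigma>, of a k] b ab by (simp add: meixner_measure_eq_negbinomial)
  qed
  then show ?thesis unfolding f m by (rule has_bochner_integral_of_real)
qed

lemma meixner_measure_factorial_moments_complex:
  assumes "\<sigma> > 0" and "Re \<alpha> \<ge> 0" and "Im \<alpha> > 0"
  shows "has_bochner_integral (meixner_measure \<alpha> (cnj \<alpha>) \<sigma>)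
    (\<lambda>x. gen_ffact (of_real x + of_real \<sigma> / \<alpha>) (\<alpha> - cnj \<alpha>) k) (gen_ffact (of_real \<sigma> / \<alpha>) (- cnj \<alpha>) k)"
proof -
  have "gen_ffact (of_real \<sigma> / \<alpha>) (- cnj \<alpha>) k = cnj \<alpha> ^ k * pochhammer (of_real (\<sigma> / (cmod \<alpha>)\<^sup>2)) k"
    by (simp only: of_real_divide_complex[of \<sigma> \<alpha>] gen_ffact_uminus_eq_pochhammer)
  then show ?thesis
    using meixner_pollaczek_factorial_moments[OF assms, of k] assms by (simp add: meixner_measure_eq_pollaczek)
qed

theorem corollaryA9:
  fixes \<sigma> :: real and \<alpha> \<beta> :: complex
    and p :: "nat \<Rightarrow> complex poly" and \<Phi> :: "complex poly \<Rightarrow> complex"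
  assumes "\<sigma> > 0" and "\<alpha> \<noteq> 0" and "\<beta> \<noteq> 0"
    and "\<And>n. degree (p n) = n" and "\<And>n. lead_coeff (p n) = 1"
    and "p 0 = 1"
    and "\<And>n. [:0, 1:] * p n =
           p (n + 1)
           + smult ((\<alpha> + \<beta>) * of_nat n + of_real \<sigma> / \<alpha>) (p n)
           + smult (of_real \<sigma> * of_nat n + \<alpha> * \<beta> * of_nat n * (of_nat n - 1)) (p (n - 1))"
    and "Vector_Spaces.linear smult (*) \<Phi>"
    and "\<Phi> 1 = 1" and "\<And>n. n \<ge> 1 \<Longrightarrow> \<Phi> (p n) = 0"
  shows "(\<forall>n\<ge>1. \<Phi> ([:0, 1:] ^ n) =
            (\<Sum>k=1..n. (\<alpha> - \<beta>) ^ (n - k) * of_nat (Stirling n k) * gen_ffact (of_real \<sigma> / \<alpha>) (- \<beta>) k))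
    \<and> (\<alpha> \<in> \<real> \<and> \<beta> \<in> \<real> \<and> Re \<alpha> \<ge> Re \<beta> \<and> Re \<beta> > 0 \<longrightarrow>
        (\<forall>n\<ge>1. integrable (meixner_measure \<alpha> \<beta> \<sigma>) (\<lambda>x. x ^ n) \<and>
          complex_of_real (LINT x|meixner_measure \<alpha> \<beta> \<sigma>. x ^ n) =
            (\<Sum>k=1..n. (\<alpha> - \<beta>) ^ (n - k) * of_nat (Stirling n k) * gen_ffact (of_real \<sigma> / \<alpha>) (- \<beta>) k)))
    \<and> (Re \<alpha> \<ge> 0 \<and> Im \<alpha> > 0 \<and> \<beta> = cnj \<alpha> \<longrightarrow>
        (\<forall>n\<ge>1. integrable (meixner_measure \<alpha> \<beta> \<sigma>) (\<lambda>x. (complex_of_real x + of_real \<sigma> / \<alpha>) ^ n) \<and>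
          (LINT x|meixner_measure \<alpha> \<beta> \<sigma>. (complex_of_real x + of_real \<sigma> / \<alpha>) ^ n) =
            (\<Sum>k=1..n. (\<alpha> - \<beta>) ^ (n - k) * of_nat (Stirling n k) * gen_ffact (of_real \<sigma> / \<alpha>) (- \<beta>) k)))"
proof (intro conjI impI allI)
  fix n :: nat assume n: "n \<ge> 1"
  \<comment> \<open>This choice brings both recurrence coefficients into the form used for the
    expansion of p_n: sigma/alpha = s beta, and the coefficient of p_(n-1) becomes alpha beta n (s +
    n - 1).\<close>
  define s where "s = of_real \<sigma> / (\<alpha> * \<beta>)"
  have sb: "s * \<beta> = of_real \<sigma> / \<alpha>" using \<open>\<beta> \<noteq> 0\<close> by (simp add: s_def)
  have coeff: "\<alpha> * \<beta> * of_nat m * (s + of_nat m - 1) = of_real \<sigma> * of_nat m + \<alpha> * \<beta> * of_nat m * (of_nat m - 1)" for m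
    using \<open>\<alpha> \<noteq> 0\<close> \<open>\<beta> \<noteq> 0\<close> by (simp add: s_def field_simps)
  have rec: "[:0, 1:] * p m = p (Suc m) + smult ((\<alpha> + \<beta>) * of_nat m + s * \<beta>) (p m)
           + smult (\<alpha> * \<beta> * of_nat m * (s + of_nat m - 1)) (p (m - 1))" for m
    unfolding coeff sb using assms(7)[of m] by simp
  have "\<Phi> (\<Prod>i<k. [:0, 1:] - of_nat i * [:\<alpha> - \<beta>:]) = gen_ffact (of_real \<sigma> / \<alpha>) (- \<beta>) k" for k
    unfolding sb[symmetric] by (rule meixner_functional_gen_ffact[of p]) (rule assms rec | assumption)+
  then show "\<Phi> ([:0, 1:] ^ n) =
            (\<Sum>k=1..n. (\<alpha> - \<beta>) ^ (n - k) * of_nat (Stirling n k) * gen_ffact (of_real \<sigma> / \<alpha>) (- \<beta>) k)"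
    by (rule functional_power_eq_sum_Stirling[OF assms(8) _ n])
next
  fix n :: nat
  assume n: "n \<ge> 1" and ab: "\<alpha> \<in> \<real> \<and> \<beta> \<in> \<real> \<and> Re \<alpha> \<ge> Re \<beta> \<and> Re \<beta> > 0"
  define a b where "a = Re \<alpha>" and "b = Re \<beta>"
  have \<alpha>\<beta>: "\<alpha> = of_real a" "\<beta> = of_real b" using ab by (simp_all add: a_def b_def)
  let ?m = "\<Sum>k=1..n. (\<alpha> - \<beta>) ^ (n - k) * of_nat (Stirling n k) * gen_ffact (of_real \<sigma> / \<alpha>) (- \<beta>) k"
  have "has_bochner_integral (meixner_measure \<alpha> \<beta> \<sigma>) (\<lambda>x. complex_of_real x ^ n) ?m"
    unfolding \<alpha>\<beta> using meixner_measure_factorial_moments_real[of b a \<sigma>] ab assms(1)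
    by (intro has_bochner_integral_power_if_gen_ffact[OF _ n]) (auto simp: a_def b_def)
  then have "has_bochner_integral (meixner_measure \<alpha> \<beta> \<sigma>) (\<lambda>x. complex_of_real (x ^ n)) ?m"
    by simp
  then show "integrable (meixner_measure \<alpha> \<beta> \<sigma>) (\<lambda>x. x ^ n)"
    and "complex_of_real (LINT x|meixner_measure \<alpha> \<beta> \<sigma>. x ^ n) = ?m"
    unfolding has_bochner_integral_iff by (simp_all only: complex_of_real_integrable_eq integral_complex_of_real)
next
  fix n :: nat
  assume n: "n \<ge> 1" and ab: "Re \<alpha> \<ge> 0 \<and> Im \<alpha> > 0 \<and> \<beta> = cnj \<alpha>"
  have "has_bochner_integral (meixner_measure \<alpha> \<beta> \<sigma>) (\<lambda>x. (complex_of_real x + of_real \<sigma> / \<alpha>) ^ n)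
    (\<Sum>k=1..n. (\<alpha> - \<beta>) ^ (n - k) * of_nat (Stirling n k) * gen_ffact (of_real \<sigma> / \<alpha>) (- \<beta>) k)"
    using meixner_measure_factorial_moments_complex[of \<sigma> \<alpha>] ab assms(1)
    by (intro has_bochner_integral_power_if_gen_ffact[OF _ n]) auto
  then show "integrable (meixner_measure \<alpha> \<beta> \<sigma>) (\<lambda>x. (complex_of_real x + of_real \<sigma> / \<alpha>) ^ n)"
    and "(LINT x|meixner_measure \<alpha> \<beta> \<sigma>. (complex_of_real x + of_real \<sigma> / \<alpha>) ^ n) =
            (\<Sum>k=1..n. (\<alpha> - \<beta>) ^ (n - k) * of_nat (Stirling n k) * gen_ffact (of_real \<sigma> / \<alpha>) (- \<beta>) k)"
    by (simp_all only: has_bochner_integral_iff)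
qed

end
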